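(* Let $\mathbf{X}\in\mathbb{R}^{N\times Q}$, let $\mathbf{Y}\in\mathbb{R}^{N\times D}$ have columns $\mathbf{y}_1,\dots,\mathbf{y}_D$, let $\tau>0$, let $\Phi=\Phi(\mathbf{X},\omega)$ be the random $N\times LK$ feature matrix defined in the context, and let the variational distribution $q(\omega)$ be fixed, of the form given in the context, with $\mathrm{KL}(q(\omega)\,\|\,p(\omega))<\infty$. Let $p(\mathbf{a})=\mathcal{N}(\mathbf{0},\mathbf{I}_{LK})$ and set $$\boldsymbol{\Sigma}=\big(E_{q(\omega)}(\Phi^T\Phi)+\tau^{-1}\mathbf{I}_{LK}\big)^{-1}.$$ Then for each $d\in\{1,\dots,D\}$, the probability density $q(\mathbf{a}_d)$ on $\mathbb{R}^{LK}$ that maximises $$\int q(\mathbf{a}_d)\int q(\omega)\log p(\mathbf{y}_d\mid \mathbf{a}_d,\mathbf{X},\omega)\,d\omega\,d\mathbf{a}_d-\mathrm{KL}(q(\mathbf{a}_d)\,\|\,p(\mathbf{a}_d))-\mathrm{KL}(q(\omega)\,\|\,p(\omega))$$ is $$q(\mathbf{a}_d)=\mathcal{N}\big(\boldsymbol{\Sigma}\,E_{q(\omega)}(\Phi^T)\,\mathbf{y}_d,\ \tau^{-1}\boldsymbol{\Sigma}\big).$$ Moreover, for $\mathbf{A}=[\mathbf{a}_1,\dots,\mathbf{a}_D]$, $q(\mathbf{A})=\prod_{d=1}^D q(\mathbf{a}_d)$ and $p(\mathbf{A})=\prod_{d=1}^D p(\mathbf{a}_d)$, with each $q(\mathbf{a}_d)$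 equal to this optimal distribution, the lower bound $$\mathcal{L}=\sum_{d=1}^D\int q(\mathbf{a}_d)\int q(\omega)\log p(\mathbf{y}_d\mid\mathbf{a}_d,\mathbf{X},\omega)\,d\omega\,d\mathbf{a}_d-\mathrm{KL}(q(\mathbf{A})\,\|\,p(\mathbf{A}))-\mathrm{KL}(q(\omega)\,\|\,p(\omega))$$ equals $$\sum_{d=1}^D\Big(-\tfrac{N}{2}\log(2\pi\tau^{-1})-\tfrac{\tau}{2}\mathbf{y}_d^T\mathbf{y}_d+\tfrac12\log\big(|\tau^{-1}\boldsymbol{\Sigma}|\big)+\tfrac12\tau\,\mathbf{y}_d^TE_{q(\omega)}(\Phi)\,\boldsymbol{\Sigma}\,E_{q(\omega)}(\Phi^T)\,\mathbf{y}_d\Big)-\mathrm{KL}(q(\omega)\,\|\,p(\omega)).$$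
   Context: Fix positive integers $N,Q,D,K,L$. Hyper-parameters: $\sigma_i>0$, $\bar{\mathbf{p}}_i\in\mathbb{R}^Q$, and positive definite diagonal $Q\times Q$ matrices $\mathbf{L}_i$ for $i=1,\dots,L$; fixed points $\mathbf{z}_k\in\mathbb{R}^Q$ for $k=1,\dots,LK$. Each index $k\in\{1,\dots,LK\}$ belongs to the component $i(k)=\lceil k/K\rceil$. Write $\omega=(\mathbf{w}_k,b_k)_{k=1}^{LK}$ with $\mathbf{w}_k\in\mathbb{R}^Q$, $b_k\in[0,2\pi]$. For $\mathbf{x}\in\mathbb{R}^Q$, $\phi(\mathbf{x},\omega)$ is the $1\times LK$ row vector with entries $$\sqrt{\tfrac{2\sigma_{i(k)}^2}{K}}\cos\big(2\pi(\mathbf{L}_{i(k)}^{-1}\mathbf{w}_k+\bar{\mathbf{p}}_{i(k)})^T(\mathbf{x}-\mathbf{z}_k)+b_k\big),\quad k=1,\dots,LK,$$ and $\Phi$ is the $N\times LK$ matrix whose $n$-th row is $\phi(\mathbf{x}_n,\omega)$, where $\mathbf{x}_n$ is the $n$-th row of $\mathbf{X}$. Likelihood: $p(\mathbf{y}_d\mid\mathbf{a}_d,\mathbf{X},\omega)=\mathcal{N}(\mathbf{y}_d;\Phi\mathbf{a}_d,\tau^{-1}\mathbf{I}_N)$ with $\mathbf{a}_d\in\mathbb{R}^{LK}$. Prior $p(\omega)$: all $\mathbf{w}_k,b_k$ independent, $\mathbf{w}_k\sim\mathcal{N}(\mathbf{0},\mathbf{I}_Q)$, $b_k\sim\mathrm{Unif}[0,2\pi]$.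 Variational distribution $q(\omega)$: all $\mathbf{w}_k,b_k$ independent, $\mathbf{w}_k\sim\mathcal{N}(\mu_k,\Sigma_k)$ with $\Sigma_k$ diagonal, $b_k\sim\mathrm{Unif}(\alpha_k,\beta_k)$ with $0\le\alpha_k\le\beta_k\le 2\pi$. $E_{q(\omega)}$ is the entrywise expectation, $|\cdot|$ the determinant, and $\mathrm{KL}(q\,\|\,p)=\int q\log(q/p)\in[0,\infty]$. The matrix $\boldsymbol{\Sigma}$ is distinct from the matrices $\Sigma_k$. *)

theory Defs
  imports "HOL-Probability.Probability"
begin

definition diagonal_matrix :: "real^'n^'n \<Rightarrow> bool" where
  "diagonal_matrix A \<longleftrightarrow> (\<forall>i j. i \<noteq> j \<longrightarrow> A $ i $ j = 0)"

definition positive_definite :: "real^'n^'n \<Rightarrow> bool" where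
  "positive_definite A \<longleftrightarrow> transpose A = A \<and> (\<forall>x. x \<noteq> 0 \<longrightarrow> 0 < x \<bullet> (A *v x))"

definition positive_semidefinite :: "real^'n^'n \<Rightarrow> bool" where
  "positive_semidefinite A \<longleftrightarrow> transpose A = A \<and> (\<forall>x. 0 \<le> x \<bullet> (A *v x))"

definition matrix_expectation :: "'w measure \<Rightarrow> ('w \<Rightarrow> real^'m^'n) \<Rightarrow> real^'m^'n" where
  "matrix_expectation M F = (\<chi> i j. \<integral>w. F w $ i $ j \<partial>M)"

text \<open>Integral with values in $[-\infty,\infty]$, needed because the expected log-likelihood may be
  $-\infty$ and the relative entropy may be $+\infty$, while the Bochner integral is $0$ in those
  cases. The value is the intended one whenever the positive or the negative part has a finite
  integral.\<close>

definition ext_integral :: "'a measure \<Rightarrow> ('a \<Rightarrow> real) \<Rightarrow> ereal" where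
  "ext_integral M f =
     enn2ereal (\<integral>\<^sup>+x. ennreal (f x) \<partial>M) - enn2ereal (\<integral>\<^sup>+x. ennreal (- f x) \<partial>M)"

text \<open>\<open>kl_div Q P\<close> is $\mathrm{KL}(Q\,\|\,P)$, the integral of $\log(dQ/dP)$ with respect to $Q$. For
  probability measures the negative part always has a finite integral. The constant
  \<open>KL_divergence\<close> of the library has its arguments in the opposite order.\<close>

definition kl_div :: "'a measure \<Rightarrow> 'a measure \<Rightarrow> ereal" where
  "kl_div Q P =
     (if absolutely_continuous P Q then ext_integral Q (entropy_density (exp 1) P Q) else \<infinity>)"

lemma ext_integral_integrable:
  assumes "integrable M f"
  shows "ext_integral M f = ereal (integral\<^sup>L M f)"
proof -
  obtain r q where rq: "0 \<le> r" "0 \<le> q" "(\<integral>\<^sup>+x. ennreal (f x) \<partial>M) = ennreal r"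
    "(\<integral>\<^sup>+x. ennreal (- f x) \<partial>M) = ennreal q" "integral\<^sup>L M f = r - q"
    using integrableE[OF assms] by metis
  then show ?thesis
    by (simp add: ext_integral_def)
qed

lemma kl_div_eq_KL_divergence:
  assumes "absolutely_continuous P Q" "integrable Q (entropy_density (exp 1) P Q)"
  shows "kl_div Q P = ereal (KL_divergence (exp 1) P Q)"
  using assms by (simp add: kl_div_def ext_integral_integrable KL_divergence_def)

lemma kl_div_density:
  fixes f g :: "'a \<Rightarrow> real"
  assumes "sigma_finite_measure M"
    and f[measurable]: "f \<in> borel_measurable M" "\<And>x. 0 \<le> f x"
    and g[measurable]: "g \<in> borel_measurable M" "\<And>x. 0 < g x"
  shows "kl_div (density M f) (density M g) = ext_integral M (\<lambda>x. f x * ln (f x / g x))"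
proof -
  interpret sigma_finite_measure M by fact
  let ?P = "density M g" and ?Q = "density M f"
  interpret P: sigma_finite_measure ?P
    by (subst sigma_finite_iff_density_finite) auto
  have Q: "density ?P (\<lambda>x. ennreal (f x / g x)) = ?Q"
    using f(2) g(2) by (subst density_density_divide) (simp_all add: less_imp_le less_imp_neq[symmetric])
  have "absolutely_continuous ?P (density ?P (\<lambda>x. ennreal (f x / g x)))"
    by (rule absolutely_continuousI_density) simp
  then have ac: "absolutely_continuous ?P ?Q"
    by (simp only: Q)
  have "AE x in ?P. ennreal (f x / g x) = RN_deriv ?P ?Q x"
    by (rule P.RN_deriv_unique) (auto simp: Q)
  then have "AE x in M. ennreal (f x / g x) = RN_deriv ?P ?Q x"
    using g(2) by (simp add: AE_density)
  then have ae: "AE x in M. entropy_density (exp 1) ?P ?Q x = ln (f x / g x)"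
  proof eventually_elim
    case (elim x)
    have "enn2real (RN_deriv ?P ?Q x) = f x / g x"
      using f(2)[of x] g(2)[of x] unfolding elim[symmetric] by simp
    then show ?case
      by (simp add: entropy_density_def log_def)
  qed
  have [measurable]: "entropy_density (exp 1) ?P ?Q \<in> borel_measurable M"
    using measurable_entropy_density[of "exp 1" ?P ?Q] by simp
  have 1: "(\<integral>\<^sup>+x. ennreal (entropy_density (exp 1) ?P ?Q x) \<partial>?Q)
      = (\<integral>\<^sup>+x. ennreal (f x * ln (f x / g x)) \<partial>M)"
  proof -
    have "(\<integral>\<^sup>+x. ennreal (entropy_density (exp 1) ?P ?Q x) \<partial>?Q)
        = (\<integral>\<^sup>+x. ennreal (f x) * ennreal (entropy_density (exp 1) ?P ?Q x) \<partial>M)"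
      by (rule nn_integral_density) measurable
    also have "\<dots> = (\<integral>\<^sup>+x. ennreal (f x * ln (f x / g x)) \<partial>M)"
      using ae by (intro nn_integral_cong_AE, eventually_elim) (simp add: ennreal_mult' f(2))
    finally show ?thesis .
  qed
  have 2: "(\<integral>\<^sup>+x. ennreal (- entropy_density (exp 1) ?P ?Q x) \<partial>?Q)
      = (\<integral>\<^sup>+x. ennreal (- (f x * ln (f x / g x))) \<partial>M)"
  proof -
    have "(\<integral>\<^sup>+x. ennreal (- entropy_density (exp 1) ?P ?Q x) \<partial>?Q)
        = (\<integral>\<^sup>+x. ennreal (f x) * ennreal (- entropy_density (exp 1) ?P ?Q x) \<partial>M)"
      by (rule nn_integral_density) measurable
    also have "\<dots> = (\<integral>\<^sup>+x. ennreal (- (f x * ln (f x / g x))) \<partial>M)"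
      using ae
      by (intro nn_integral_cong_AE, eventually_elim) (simp flip: ennreal_mult' add: f(2))
    finally show ?thesis .
  qed
  show ?thesis
    using ac 1 2 by (simp add: kl_div_def ext_integral_def)
qed

definition prob_density :: "('a::euclidean_space \<Rightarrow> real) \<Rightarrow> bool" where
  "prob_density f \<longleftrightarrow>
     f \<in> borel_measurable borel \<and> (\<forall>x. 0 \<le> f x) \<and> (\<integral>\<^sup>+x. ennreal (f x) \<partial>lborel) = 1"

definition mvn_density :: "real^'n \<Rightarrow> real^'n^'n \<Rightarrow> real^'n \<Rightarrow> real" where
  "mvn_density m S x =
     exp (- (1/2) * ((x - m) \<bullet> (matrix_inv S *v (x - m)))) / sqrt ((2 * pi) ^ CARD('n) * det S)"

text \<open>The law $\mathcal N(m,S)$ for a diagonal positive semidefinite \<open>S\<close>, as the law of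
  $m + S^{1/2}\xi$ with $\xi\sim\mathcal N(0,I)$; the entrywise square root is the matrix square root
  of a diagonal matrix. Zero variances are allowed.\<close>

definition diag_normal :: "real^'n \<Rightarrow> real^'n^'n \<Rightarrow> (real^'n) measure" where
  "diag_normal m S =
     distr (density lborel (mvn_density 0 (mat 1))) borel
       (\<lambda>\<xi>. m + (\<chi> i j. sqrt (S $ i $ j)) *v \<xi>)"

lemma matrix_inv_eqI:
  fixes A :: "real^'n^'n"
  assumes "A ** B = mat 1" "B ** A = mat 1"
  shows "matrix_inv A = B"
proof -
  have "A ** matrix_inv A = mat 1 \<and> matrix_inv A ** A = mat 1"
    unfolding matrix_inv_def by (rule someI[of _ B]) (simp add: assms)
  then show ?thesis
    by (metis assms(2) matrix_mul_assoc matrix_mul_lid matrix_mul_rid)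
qed

lemma borel_measurable_mvn_density [measurable]: "mvn_density m S \<in> borel_measurable borel"
proof -
  have "continuous_on UNIV (\<lambda>x. matrix_inv S *v (x - m))"
    by (rule bounded_linear.continuous_on[OF matrix_vector_mul_bounded_linear])
      (intro continuous_intros)
  then have [measurable]: "(\<lambda>x. matrix_inv S *v (x - m)) \<in> borel_measurable borel"
    by (rule borel_measurable_continuous_onI)
  show ?thesis
    unfolding mvn_density_def[abs_def] by measurable
qed

lemma diag_normal_eq_density:
  fixes m :: "real^'n"
  assumes diag: "diagonal_matrix S" and pos: "\<And>i. 0 < S $ i $ i"
  shows "diag_normal m S = density lborel (mvn_density m S)"
proof -
  define c :: "real^'n \<Rightarrow> real" where "c b = sqrt (b \<bullet> (S *v b))" for b
  define T where "T \<xi> = m + (\<Sum>b\<in>Basis. (c b * (\<xi> \<bullet> b)) *\<^sub>R b)" for \<xi> :: "real^'n"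
  have S0: "S $ i $ j = (if i = j then S $ i $ i else 0)" for i j
    using diag by (auto simp: diagonal_matrix_def)
  have Sv: "(S *v x) $ i = S $ i $ i * x $ i" for x i
    unfolding matrix_vector_mult_def by (subst S0) (simp add: if_distrib[of "\<lambda>t. t * _"] cong: if_cong)
  have Rij: "sqrt (S $ i $ j) * t = (if i = j then sqrt (S $ i $ i) * t else 0)" for i j t
    by (subst S0) simp
  have Rv: "((\<chi> i j. sqrt (S $ i $ j)) *v x) $ i = sqrt (S $ i $ i) * x $ i" for x i
    unfolding matrix_vector_mult_def vec_lambda_beta by (subst Rij) simp
  have c_axis: "c (axis i 1) = sqrt (S $ i $ i)" for i
    by (simp add: c_def inner_axis' Sv)
  have inj: "inj (\<lambda>i::'n. axis i (1::real))"
    by (simp add: inj_on_def axis_eq_axis)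
  have Basis: "(Basis :: (real^'n) set) = range (\<lambda>i. axis i 1)"
    by (auto simp: Basis_vec_def)
  have T: "T = (\<lambda>\<xi>. m + (\<chi> i j. sqrt (S $ i $ j)) *v \<xi>)"
  proof
    fix \<xi> :: "real^'n"
    have "(\<Sum>b\<in>Basis. (c b * (\<xi> \<bullet> b)) *\<^sub>R b) = (\<Sum>i\<in>UNIV. (sqrt (S $ i $ i) * \<xi> $ i) *\<^sub>R axis i 1)"
      unfolding Basis by (subst sum.reindex[OF inj]) (simp add: c_axis inner_axis)
    also have "\<dots> = (\<chi> i j. sqrt (S $ i $ j)) *v \<xi>"
      by (simp add: vec_eq_iff Rv axis_def if_distrib[of "\<lambda>t. _ * t"] cong: if_cong)
    finally show "T \<xi> = m + (\<chi> i j. sqrt (S $ i $ j)) *v \<xi>"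
      by (simp add: T_def)
  qed
  let ?C = "\<Prod>b\<in>Basis. \<bar>c b\<bar>"
  have C: "?C = (\<Prod>i\<in>UNIV. sqrt (S $ i $ i))"
    unfolding Basis using pos by (subst prod.reindex[OF inj]) (simp add: c_axis less_imp_le)
  have C_pos: "0 < ?C"
    unfolding C using pos by (simp add: prod_pos)
  have det: "det S = ?C\<^sup>2"
    unfolding C using diag pos
    by (subst det_diagonal) (simp_all add: diagonal_matrix_def power2_eq_square less_imp_le flip: prod.distrib)
  define J :: "real^'n^'n" where "J = (\<chi> i j. if i = j then 1 / S $ i $ i else 0)"
  have Jv: "(J *v x) $ i = x $ i / S $ i $ i" for x i
    unfolding matrix_vector_mult_def J_def by (simp add: if_distrib[of "\<lambda>t. t * _"] cong: if_cong)
  have pos': "S $ i $ i \<noteq> 0" for i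
    using pos[of i] by simp
  have "S ** J = mat 1" "J ** S = mat 1"
    using pos' unfolding matrix_eq
    by (auto simp: vec_eq_iff Sv Jv simp flip: matrix_vector_mul_assoc)
  then have inv: "matrix_inv S = J"
    by (rule matrix_inv_eqI)
  have inv1: "matrix_inv (mat 1 :: real^'n^'n) = mat 1"
    by (rule matrix_inv_eqI) simp_all
  have quad: "(T \<xi> - m) \<bullet> (J *v (T \<xi> - m)) = \<xi> \<bullet> \<xi>" for \<xi>
  proof -
    have "(T \<xi> - m) $ i = sqrt (S $ i $ i) * \<xi> $ i" for i
      by (simp add: T Rv)
    moreover have "sqrt s * t * (sqrt s * t) / s = t * t" if "0 < s" for s t :: real
      using that real_sqrt_mult_self[of s] by (simp add: field_simps)
    ultimately show ?thesis
      using pos by (simp add: inner_vec_def Jv)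
  qed
  have c0: "c b \<noteq> 0" if "b \<in> Basis" for b
    using that pos' unfolding Basis by (auto simp: c_axis)
  have dens: "?C * mvn_density m S (T \<xi>) = mvn_density 0 (mat 1) \<xi>" for \<xi>
    using C_pos by (simp add: mvn_density_def inv inv1 quad det real_sqrt_mult c0)
  have [measurable]: "T \<in> borel \<rightarrow>\<^sub>M borel"
    unfolding T_def by measurable
  have "lborel = density (distr lborel borel T) (\<lambda>_. ennreal ?C)"
    unfolding T_def[abs_def]
    by (rule lborel_affine_euclidean) (rule c0)
  then have "density lborel (mvn_density m S)
      = density (density (distr lborel borel T) (\<lambda>_. ennreal ?C)) (mvn_density m S)"
    by simp
  also have "\<dots> = density (distr lborel borel T) (\<lambda>x. ennreal ?C * ennreal (mvn_density m S x))"
    by (rule density_density_eq) auto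
  also have "\<dots> = distr (density lborel (\<lambda>\<xi>. ennreal ?C * ennreal (mvn_density m S (T \<xi>)))) borel T"
    by (rule density_distr) auto
  also have "(\<lambda>\<xi>. ennreal ?C * ennreal (mvn_density m S (T \<xi>))) = (\<lambda>\<xi>. ennreal (mvn_density 0 (mat 1) \<xi>))"
    using C_pos by (simp add: ennreal_mult'[symmetric] dens less_imp_le)
  finally show ?thesis
    by (simp add: diag_normal_def T)
qed

text \<open>The library's \<open>uniform_measure\<close> of an interval of length zero is the null measure, so the
  degenerate uniform law is treated separately.\<close>

definition uniform_law :: "real \<Rightarrow> real \<Rightarrow> real measure" where
  "uniform_law a b = (if a < b then uniform_measure lborel {a..b} else return borel a)"

text \<open>An index $k\in\{1,\dots,LK\}$ is encoded as the pair $(i,j)$ with $k=(i-1)K+j$, so that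
  $i(k)=\lceil k/K\rceil$ is the first component; $L$ and $K$ are the cardinalities of \<open>'l\<close> and
  \<open>'k\<close>. A value of $\omega$ maps \<open>k\<close> to $(w_k,b_k)$.\<close>

type_synonym ('q, 'l, 'k) freqs = "'l \<times> 'k \<Rightarrow> (real^'q) \<times> real"

definition feature ::
  "('l::finite \<Rightarrow> real) \<Rightarrow> ('l \<Rightarrow> real^'q) \<Rightarrow> ('l \<Rightarrow> real^'q^'q) \<Rightarrow> ('l \<times> 'k::finite \<Rightarrow> real^'q)
    \<Rightarrow> real^'q \<Rightarrow> ('q, 'l, 'k) freqs \<Rightarrow> real^('l \<times> 'k)" where
  "feature \<sigma> p Lm z x \<omega> =
     (\<chi> k. sqrt (2 * (\<sigma> (fst k))\<^sup>2 / real CARD('k)) *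
        cos (2 * pi * ((matrix_inv (Lm (fst k)) *v fst (\<omega> k) + p (fst k)) \<bullet> (x - z k)) + snd (\<omega> k)))"

definition feature_matrix ::
  "('l::finite \<Rightarrow> real) \<Rightarrow> ('l \<Rightarrow> real^'q) \<Rightarrow> ('l \<Rightarrow> real^'q^'q) \<Rightarrow> ('l \<times> 'k::finite \<Rightarrow> real^'q)
    \<Rightarrow> real^'q^'n \<Rightarrow> ('q, 'l, 'k) freqs \<Rightarrow> real^('l \<times> 'k)^'n" where
  "feature_matrix \<sigma> p Lm z X \<omega> = (\<chi> n. feature \<sigma> p Lm z (row n X) \<omega>)"

definition prior_freqs :: "('q::finite, 'l::finite, 'k::finite) freqs measure" where
  "prior_freqs =
     (\<Pi>\<^sub>M k\<in>UNIV. density lborel (mvn_density 0 (mat 1)) \<Otimes>\<^sub>M uniform_law 0 (2 * pi))"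

definition var_freqs ::
  "('l \<times> 'k \<Rightarrow> real^'q) \<Rightarrow> ('l \<times> 'k \<Rightarrow> real^'q^'q) \<Rightarrow> ('l \<times> 'k \<Rightarrow> real) \<Rightarrow> ('l \<times> 'k \<Rightarrow> real)
    \<Rightarrow> ('q::finite, 'l::finite, 'k::finite) freqs measure" where
  "var_freqs \<mu> S \<alpha> \<beta> = (\<Pi>\<^sub>M k\<in>UNIV. diag_normal (\<mu> k) (S k) \<Otimes>\<^sub>M uniform_law (\<alpha> k) (\<beta> k))"

definition likelihood :: "real \<Rightarrow> real^'m^'n \<Rightarrow> real^'m \<Rightarrow> real^'n \<Rightarrow> real" where
  "likelihood \<tau> \<Phi> a y = mvn_density (\<Phi> *v a) ((1 / \<tau>) *\<^sub>R mat 1) y"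

definition expected_loglik ::
  "'w measure \<Rightarrow> real \<Rightarrow> ('w \<Rightarrow> real^'m^'n) \<Rightarrow> real^'n \<Rightarrow> (real^'m \<Rightarrow> real) \<Rightarrow> ereal" where
  "expected_loglik Q \<tau> \<Phi> y qa =
     ext_integral lborel (\<lambda>a. qa a * (\<integral>\<omega>. ln (likelihood \<tau> (\<Phi> \<omega>) a y) \<partial>Q))"

definition column_bound ::
  "'w measure \<Rightarrow> 'w measure \<Rightarrow> real \<Rightarrow> ('w \<Rightarrow> real^'m^'n) \<Rightarrow> real^'n \<Rightarrow> (real^'m \<Rightarrow> real) \<Rightarrow> ereal"
  where
  "column_bound Q P \<tau> \<Phi> y qa =
     expected_loglik Q \<tau> \<Phi> y qa
     - kl_div (density lborel qa) (density lborel (mvn_density 0 (mat 1)))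
     - kl_div Q P"

definition lower_bound ::
  "'w measure \<Rightarrow> 'w measure \<Rightarrow> real \<Rightarrow> ('w \<Rightarrow> real^'m^'n) \<Rightarrow> real^'d^'n
    \<Rightarrow> ('d \<Rightarrow> real^'m \<Rightarrow> real) \<Rightarrow> ereal" where
  "lower_bound Q P \<tau> \<Phi> Y qa =
     (\<Sum>d\<in>UNIV. expected_loglik Q \<tau> \<Phi> (column d Y) (qa d))
     - kl_div (density lborel (\<lambda>A::real^'d^'m. \<Prod>d\<in>UNIV. qa d (column d A)))
              (density lborel (\<lambda>A::real^'d^'m. \<Prod>d\<in>UNIV. mvn_density 0 (mat 1) (column d A)))
     - kl_div Q P"

end

theory Submission
  imports Defs
begin

text \<open>Under $q(\omega)$ the features are bounded, so the expected log-likelihood $g$ is a quadratic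
  function of $a$, and completing the square gives $g + \log p = c + \log q^*$ pointwise, where $p$ is
  the prior density of $a$, $q^*$ the claimed Gaussian density and $c$ a constant. Hence
  $\int r g - \mathrm{KL}(r\,\|\,p) = c - \mathrm{KL}(r\,\|\,q^*)$ whenever both terms on the left are
  finite, and Gibbs' inequality yields both the optimality and the uniqueness of $q^*$. If one of them
  is infinite the objective is $-\infty$, because $g$ is bounded above and $\mathrm{KL}$ is never
  $-\infty$. The optimal value is the sum of the constants $c$, since relative entropy is additive over
  the independent columns of $A$.\<close>

section \<open>Lebesgue measure and linear maps\<close>

text \<open>The objective lives in \<open>ereal\<close>, where
  \<open>\<infinity> - \<infinity>\<close> evaluates to \<open>\<infinity>\<close>: an indeterminate
  difference would beat every density. So the expected log-likelihood must be kept away from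
  \<open>\<infinity>\<close> and the relative entropy away from \<open>-\<infinity>\<close> before
  they are subtracted; only then can the algebra move to Bochner integrals. No Gaussian moment is
  ever computed. The pointwise identity makes c the logarithm of the integral of p exp g, and the
  relative entropy of q* with respect to p cancels from the optimal value. What remains analytic is
  that a normal density with arbitrary positive definite covariance has mass one and that quadratic
  functions are integrable against it. The mass requires a linear substitution, which is why
  Lebesgue measure under linear maps is treated at the start. Finiteness of KL(q(\<omega>) ||
  p(\<omega>)) is what gives uniqueness a meaning: were it infinite, all densities would share the
  value \<open>-\<infinity>\<close>.\<close>

lemma borel_measurable_vec_nth [measurable]:
  "(\<lambda>x::'a::euclidean_space^'n. x $ i) \<in> borel_measurable borel"
  by (intro borel_measurable_continuous_onI continuous_intros)

lemma borel_measurable_vec_lambda: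
  fixes f :: "'n::finite \<Rightarrow> 'b \<Rightarrow> 'a::euclidean_space"
  assumes [measurable]: "\<And>i. f i \<in> borel_measurable M"
  shows "(\<lambda>x. \<chi> i. f i x) \<in> borel_measurable M"
proof (subst borel_measurable_euclidean_space, safe)
  fix b :: "'a^'n" assume "b \<in> Basis"
  then obtain i u where b: "b = axis i u" "u \<in> Basis"
    by (auto simp: Basis_vec_def)
  show "(\<lambda>x. (\<chi> i. f i x) \<bullet> b) \<in> borel_measurable M"
    unfolding b inner_axis by simp
qed

lemma borel_measurable_matrix_vector_mult [measurable]:
  fixes A :: "real^'m^'n"
  shows "(\<lambda>x. A *v x) \<in> borel_measurable borel"
  by (intro borel_measurable_continuous_onI matrix_vector_mult_linear_continuous_on)

text \<open>Permuting coordinates pulls a box back to a box with the same side lengths, and boxes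
  determine Lebesgue measure. The two spaces may have different types, so this serves both for
  exchanging two coordinates and for transposing a matrix.\<close>

lemma lborel_distr_permute_Basis:
  fixes T :: "'a::euclidean_space \<Rightarrow> 'b::euclidean_space"
  assumes T: "T \<in> borel_measurable borel"
    and \<pi>: "bij_betw \<pi> Basis Basis" "\<And>x b. b \<in> Basis \<Longrightarrow> T x \<bullet> b = x \<bullet> \<pi> b"
  shows "distr lborel borel T = lborel"
proof (rule lborel_eqI[symmetric])
  fix l u :: 'b assume le: "\<And>b. b \<in> Basis \<Longrightarrow> l \<bullet> b \<le> u \<bullet> b"
  \<comment> \<open>\<open>g\<close> is the inverse of \<open>T\<close> in coordinates, so it sends
    the corners of a box to the corners of its preimage.\<close>
  define g where "g v = (\<Sum>b\<in>Basis. (v \<bullet> b) *\<^sub>R \<pi> b)" for v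
  have inj: "inj_on \<pi> Basis" and im: "\<pi> ` Basis = Basis"
    using \<pi>(1) by (auto simp: bij_betw_def)
  have g: "g v \<bullet> \<pi> b = v \<bullet> b" if "b \<in> Basis" for v b
  proof -
    have "g v \<bullet> \<pi> b = (\<Sum>c\<in>Basis. (v \<bullet> c) * (\<pi> c \<bullet> \<pi> b))"
      by (simp add: g_def inner_sum_left)
    also have "\<dots> = (\<Sum>c\<in>Basis. if c = b then v \<bullet> c else 0)"
    proof (intro sum.cong refl)
      fix c :: 'b assume "c \<in> Basis"
      then have "\<pi> c \<in> Basis" "\<pi> b \<in> Basis" "\<pi> c = \<pi> b \<longleftrightarrow> c = b"
        using that im inj_on_eq_iff[OF inj, of c b] by blast+
      then have "\<pi> c \<bullet> \<pi> b = (if c = b then 1 else 0)"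
        by (simp add: inner_Basis)
      then show "(v \<bullet> c) * (\<pi> c \<bullet> \<pi> b) = (if c = b then v \<bullet> c else 0)"
        by simp
    qed
    finally show ?thesis using that by simp
  qed
  have ball: "(\<forall>c\<in>Basis. Q c) \<longleftrightarrow> (\<forall>b\<in>Basis. Q (\<pi> b))" for Q
    using im by (metis (no_types, lifting) imageE imageI)
  have "T -` box l u = box (g l) (g u)"
    by (auto simp: box_def ball[of "\<lambda>c. _ \<bullet> c < _ \<bullet> c \<and> _ \<bullet> c < _ \<bullet> c"] g \<pi>(2))
  then have "emeasure (distr lborel borel T) (box l u) = emeasure lborel (box (g l) (g u))"
    using T by (simp add: emeasure_distr)
  also have "\<dots> = (\<Prod>c\<in>Basis. (g u - g l) \<bullet> c)"
    using le ball[of "\<lambda>c. g l \<bullet> c \<le> g u \<bullet> c"] by (intro emeasure_lborel_box) (auto simp: g)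
  also have "(\<Prod>c\<in>Basis. (g u - g l) \<bullet> c) = (\<Prod>b\<in>Basis. (u - l) \<bullet> b)"
    by (subst im[symmetric], subst prod.reindex[OF inj]) (simp add: g inner_diff_left)
  finally show "emeasure (distr lborel borel T) (box l u) = (\<Prod>b\<in>Basis. (u - l) \<bullet> b)"
    by simp
qed simp

lemma measurable_vec_lambda_PiM [measurable]:
  "(\<lambda>f::'n::finite \<Rightarrow> 'a::euclidean_space. \<chi> i. f i) \<in> (\<Pi>\<^sub>M i\<in>UNIV. lborel) \<rightarrow>\<^sub>M borel"
  by (rule borel_measurable_vec_lambda) measurable

text \<open>The components may themselves be vectors: real ones isolate a single coordinate for the
  shear below, vector ones isolate a column of a matrix.\<close>

lemma lborel_vec_eq:
  "(lborel :: ('a::euclidean_space^'n) measure) =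
     distr (\<Pi>\<^sub>M i\<in>UNIV. lborel) borel (\<lambda>f. \<chi> i. f i)"
proof (rule lborel_eqI)
  fix l u :: "'a^'n" assume le: "\<And>b. b \<in> Basis \<Longrightarrow> l \<bullet> b \<le> u \<bullet> b"
  interpret product_sigma_finite "\<lambda>_::'n. lborel :: 'a measure"
    by standard
  have le': "l $ i \<bullet> b \<le> u $ i \<bullet> b" if "b \<in> Basis" for i b
    using le[of "axis i b"] that by (auto simp: inner_axis Basis_vec_def)
  have vim: "(\<lambda>f. \<chi> i. f i) -` box l u = (\<Pi>\<^sub>E i\<in>UNIV. box (l $ i) (u $ i))"
    by (auto simp: box_def Basis_vec_def inner_axis PiE_UNIV_domain)
  have disj: "(Basis :: ('a^'n) set) = (\<Union>i\<in>UNIV. axis i ` Basis)"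
    by (auto simp: Basis_vec_def)
  have "emeasure (distr (\<Pi>\<^sub>M i\<in>UNIV. lborel) borel (\<lambda>f. \<chi> i. f i)) (box l u)
      = (\<Prod>i\<in>UNIV. emeasure lborel (box (l $ i) (u $ i)))"
    by (subst emeasure_distr) (auto simp: vim space_PiM emeasure_PiM)
  also have "\<dots> = (\<Prod>i\<in>UNIV. ennreal (\<Prod>b\<in>Basis. (u $ i - l $ i) \<bullet> b))"
    by (intro prod.cong emeasure_lborel_box) (auto simp: le')
  also have "\<dots> = ennreal (\<Prod>i\<in>UNIV. \<Prod>b\<in>Basis. (u $ i - l $ i) \<bullet> b)"
    by (intro prod_ennreal prod_nonneg) (auto simp: inner_diff_left le')
  also have "(\<Prod>i\<in>UNIV. \<Prod>b\<in>Basis. (u $ i - l $ i) \<bullet> b) = (\<Prod>b\<in>Basis. (u - l) \<bullet> b)"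
    unfolding disj
    by (subst prod.UNION_disjoint)
      (auto simp: axis_eq_axis prod.reindex inj_on_def inner_axis dest: nonzero_Basis)
  finally show "emeasure (distr (\<Pi>\<^sub>M i\<in>UNIV. lborel) borel (\<lambda>f. \<chi> i. f i)) (box l u)
      = (\<Prod>b\<in>Basis. (u - l) \<bullet> b)" .
qed simp

text \<open>Fubini singles out coordinate \<open>m\<close>. With the others fixed, among them
  coordinate \<open>n\<close> because \<open>m \<noteq> n\<close>, the map is a translation of the
  real line.\<close>

lemma nn_integral_lborel_shear:
  fixes F :: "real^'n \<Rightarrow> ennreal"
  assumes [measurable]: "F \<in> borel_measurable borel" and mn: "m \<noteq> n"
  shows "(\<integral>\<^sup>+x. F (\<chi> i. if i = m then x $ m + x $ n else x $ i) \<partial>lborel) = (\<integral>\<^sup>+x. F x \<partial>lborel)"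
proof -
  interpret product_sigma_finite "\<lambda>_::'n. lborel :: real measure"
    by standard
  let ?J = "UNIV - {m}"
  have U: "UNIV = insert m ?J" by auto
  have fub: "(\<integral>\<^sup>+x. G x \<partial>lborel)
      = (\<integral>\<^sup>+g. \<integral>\<^sup>+y. G (\<chi> i. if i = m then y else g i) \<partial>lborel \<partial>(\<Pi>\<^sub>M i\<in>?J. lborel))"
    if [measurable]: "G \<in> borel_measurable borel" for G :: "real^'n \<Rightarrow> ennreal"
  proof -
    have "(\<integral>\<^sup>+x. G x \<partial>lborel) = (\<integral>\<^sup>+f. G (\<chi> i. f i) \<partial>(\<Pi>\<^sub>M i\<in>UNIV. lborel))"
      by (subst lborel_vec_eq, subst nn_integral_distr) auto
    also have "\<dots> = (\<integral>\<^sup>+f. G (\<chi> i. f i) \<partial>(\<Pi>\<^sub>M i\<in>insert m ?J. lborel))"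
      by (simp only: U[symmetric])
    also have "\<dots> = (\<integral>\<^sup>+g. \<integral>\<^sup>+y. G (\<chi> i. (g(m := y)) i) \<partial>lborel \<partial>(\<Pi>\<^sub>M i\<in>?J. lborel))"
    proof (rule product_nn_integral_insert)
      have "(\<lambda>f. G (\<chi> i. f i)) \<in> borel_measurable (\<Pi>\<^sub>M i\<in>UNIV. lborel)"
        by measurable
      then show "(\<lambda>f. G (\<chi> i. f i)) \<in> borel_measurable (\<Pi>\<^sub>M i\<in>insert m ?J. lborel)"
        by (simp only: U[symmetric])
    qed auto
    finally show ?thesis by (simp add: fun_upd_def)
  qed
  have [measurable]: "(\<lambda>x::real^'n. \<chi> i. if i = m then x $ m + x $ n else x $ i) \<in> borel_measurable borel"
    by (rule borel_measurable_vec_lambda) measurable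
  have [measurable]: "(\<lambda>y. \<chi> i. if i = m then y else g i) \<in> borel_measurable borel" for g :: "'n \<Rightarrow> real"
    by (rule borel_measurable_vec_lambda) measurable
  have "(\<integral>\<^sup>+y. F (\<chi> i. if i = m then g n + y else g i) \<partial>lborel)
      = (\<integral>\<^sup>+y. F (\<chi> i. if i = m then y else g i) \<partial>lborel)" for g :: "'n \<Rightarrow> real"
    using nn_integral_real_affine[of "\<lambda>y. F (\<chi> i. if i = m then y else g i)" 1 "g n"]
    by (simp cong: if_cong)
  moreover have "(\<chi> i. if i = m then (\<chi> i. if i = m then y else g i) $ m + (\<chi> i. if i = m then y else g i) $ n
       else (\<chi> i. if i = m then y else g i) $ i) = (\<chi> i. if i = m then g n + y else g i)" for y and g :: "'n \<Rightarrow> real"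
    using mn by (simp add: vec_eq_iff add.commute)
  ultimately show ?thesis
    by (simp add: fub)
qed

text \<open>The library's change of variables for linear maps assumes a well-ordered index type, which
  \<^typ>\<open>'l \<times> 'k\<close> need not be.\<close>

lemma nn_integral_lborel_matrix:
  fixes A :: "real^'n^'n" and F :: "real^'n \<Rightarrow> ennreal"
  assumes "det A \<noteq> 0" and F: "F \<in> borel_measurable borel"
  shows "ennreal \<bar>det A\<bar> * (\<integral>\<^sup>+x. F (A *v x) \<partial>lborel) = (\<integral>\<^sup>+x. F x \<partial>lborel)"
proof -
  \<comment> \<open>\<open>F\<close> is quantified inside \<open>P\<close> because the product case
    applies the hypothesis for \<open>B\<close> to the function that maps x to
    \<open>F (A *v x)\<close>. The guard on the determinant makes the case of a zero row
    vacuous.\<close>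
  define P where "P A \<longleftrightarrow> det A \<noteq> 0 \<longrightarrow> (\<forall>F\<in>borel_measurable borel.
    ennreal \<bar>det A\<bar> * (\<integral>\<^sup>+x. F (A *v x) \<partial>lborel) = (\<integral>\<^sup>+x. F x \<partial>lborel))" for A :: "real^'n^'n"
  have "P A"
  proof (rule induct_matrix_elementary_alt)
    fix A B :: "real^'n^'n" assume A: "P A" and B: "P B"
    show "P (A ** B)"
      unfolding P_def
    proof safe
      fix F :: "real^'n \<Rightarrow> ennreal" assume [measurable]: "F \<in> borel_measurable borel"
        and d: "det (A ** B) \<noteq> 0"
      have "ennreal \<bar>det (A ** B)\<bar> * (\<integral>\<^sup>+x. F ((A ** B) *v x) \<partial>lborel)
          = ennreal \<bar>det A\<bar> * (ennreal \<bar>det B\<bar> * (\<integral>\<^sup>+x. F (A *v (B *v x)) \<partial>lborel))"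
        by (simp add: det_mul abs_mult ennreal_mult mult.assoc flip: matrix_vector_mul_assoc)
      also have "ennreal \<bar>det B\<bar> * (\<integral>\<^sup>+x. F (A *v (B *v x)) \<partial>lborel) = (\<integral>\<^sup>+x. F (A *v x) \<partial>lborel)"
        using B d unfolding P_def by (auto simp: det_mul)
      also have "ennreal \<bar>det A\<bar> * \<dots> = (\<integral>\<^sup>+x. F x \<partial>lborel)"
        using A d unfolding P_def by (auto simp: det_mul)
      finally show "ennreal \<bar>det (A ** B)\<bar> * (\<integral>\<^sup>+x. F ((A ** B) *v x) \<partial>lborel) = (\<integral>\<^sup>+x. F x \<partial>lborel)" .
    qed
  next
    fix A :: "real^'n^'n" and i assume "row i A = 0"
    then show "P A" using det_zero_row by (auto simp: P_def)
  next
    fix A :: "real^'n^'n" assume diag: "\<And>i j. i \<noteq> j \<Longrightarrow> A $ i $ j = 0"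
    show "P A"
      unfolding P_def
    proof safe
      fix F :: "real^'n \<Rightarrow> ennreal" assume [measurable]: "F \<in> borel_measurable borel"
        and d: "det A \<noteq> 0"
      have det: "det A = (\<Prod>i\<in>UNIV. A $ i $ i)"
        by (rule det_diagonal) (rule diag)
      \<comment> \<open>The diagonal entry in direction \<open>b\<close>, written as a quadratic
        form because \<open>lborel_affine_euclidean\<close> indexes its scale factors by basis
        vectors.\<close>
      define c where "c b = b \<bullet> (A *v b)" for b
      have Av: "(A *v x) $ i = A $ i $ i * x $ i" for x i
        unfolding matrix_vector_mult_def
        by (simp add: sum.remove[of UNIV i] diag)
      have c: "c (axis i 1) = A $ i $ i" for i
        by (simp add: c_def inner_axis' Av)
      have inj: "inj (\<lambda>i::'n. axis i (1::real))"
        by (simp add: inj_on_def axis_eq_axis)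
      have Basis: "(Basis :: (real^'n) set) = range (\<lambda>i. axis i 1)"
        by (auto simp: Basis_vec_def)
      have T: "0 + (\<Sum>j\<in>Basis. (c j * (x \<bullet> j)) *\<^sub>R j) = A *v x" for x
        unfolding Basis
        by (subst sum.reindex[OF inj])
          (simp add: c inner_axis, simp add: vec_eq_iff Av axis_def if_distrib[of "\<lambda>t. _ * t"] cong: if_cong)
      have prod: "(\<Prod>b\<in>Basis. \<bar>c b\<bar>) = \<bar>det A\<bar>"
        unfolding Basis by (subst prod.reindex[OF inj]) (simp add: c det abs_prod)
      have "c b \<noteq> 0" if "b \<in> Basis" for b
        using that d unfolding det Basis by (auto simp: c)
      then have "lborel = density (distr lborel borel (\<lambda>x. A *v x)) (\<lambda>_. ennreal \<bar>det A\<bar>)"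
        using lborel_affine_euclidean[of c 0] unfolding T prod by blast
      then have "(\<integral>\<^sup>+x. F x \<partial>lborel) = (\<integral>\<^sup>+x. F x \<partial>density (distr lborel borel (\<lambda>x. A *v x)) (\<lambda>_. ennreal \<bar>det A\<bar>))"
        by simp
      then show "ennreal \<bar>det A\<bar> * (\<integral>\<^sup>+x. F (A *v x) \<partial>lborel) = (\<integral>\<^sup>+x. F x \<partial>lborel)"
        by (simp add: nn_integral_density nn_integral_distr nn_integral_cmult)
    qed
  next
    fix m n :: 'n assume "m \<noteq> n"
    let ?t = "Transposition.transpose m n"
    let ?A = "(\<chi> i j. mat 1 $ i $ ?t j) :: real^'n^'n"
    have Av: "(?A *v x) $ i = x $ ?t i" for x i
    proof -
      have "(mat 1 :: real^'n^'n) $ i $ ?t j * x $ j = (if j = ?t i then x $ j else 0)" for j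
        by (auto simp: mat_def)
      then show ?thesis by (simp add: matrix_vector_mult_def)
    qed
    define \<pi> :: "real^'n \<Rightarrow> real^'n" where "\<pi> b = (\<chi> i. b $ ?t i)" for b
    have inv: "\<pi> (\<pi> b) = b" for b by (simp add: \<pi>_def vec_eq_iff)
    have ax: "\<pi> (axis i 1) = axis (?t i) 1" for i
      by (auto simp: \<pi>_def vec_eq_iff axis_def)
    have Basis: "(Basis :: (real^'n) set) = range (\<lambda>i. axis i 1)"
      by (auto simp: Basis_vec_def)
    have "distr lborel borel (\<lambda>x. ?A *v x) = lborel"
    proof (rule lborel_distr_permute_Basis)
      show "bij_betw \<pi> Basis Basis"
        by (rule bij_betwI[of _ _ _ \<pi>]) (auto simp: inv Basis ax)
      show "(?A *v x) \<bullet> b = x \<bullet> \<pi> b" if "b \<in> Basis" for x b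
        using that by (auto simp: Basis ax inner_axis Av)
    qed measurable
    moreover have "\<bar>det ?A\<bar> = 1"
    proof -
      have "det ?A = of_int (sign ?t) * det (mat 1 :: real^'n^'n)"
        by (rule det_permute_columns) (simp add: permutes_swap_id)
      then show ?thesis by (simp add: sign_swap_id \<open>m \<noteq> n\<close>)
    qed
    ultimately show "P ?A"
      unfolding P_def using nn_integral_distr[of "\<lambda>x. ?A *v x" lborel borel]
      by (metis (no_types, lifting) borel_measurable_matrix_vector_mult ennreal_1 measurable_lborel2 mult_1)
  next
    fix m n :: 'n assume mn: "m \<noteq> n"
    let ?A = "(\<chi> i j. of_bool (i = m \<and> j = n \<or> i = j)) :: real^'n^'n"
    have "?A = (\<chi> k. if k = m then row m (mat 1) + 1 *s row n (mat 1) else row k (mat 1))"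
      using mn by (auto simp: vec_eq_iff row_def mat_def)
    then have "det ?A = 1"
      using det_row_operation[OF mn, where A = "mat 1 :: real^'n^'n" and c = 1] by simp
    moreover have "?A *v x = (\<chi> i. if i = m then x $ m + x $ n else x $ i)" for x
    proof -
      have "(of_bool (i = m \<and> j = n \<or> i = j) :: real) * x $ j
          = (if j = i then x $ j else 0) + (if i = m \<and> j = n then x $ j else 0)" for i j
        using mn by auto
      then show ?thesis
        by (auto simp: matrix_vector_mult_def vec_eq_iff sum.distrib)
    qed
    ultimately show "P ?A"
      unfolding P_def using mn by (simp add: nn_integral_lborel_shear)
  qed
  then show ?thesis using assms by (simp add: P_def)
qed

section \<open>Multivariate normal densities\<close>

lemma inner_matrix_symmetric:
  fixes A :: "real^'n^'n"
  assumes "transpose A = A"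
  shows "x \<bullet> (A *v y) = y \<bullet> (A *v x)"
  using assms by (metis dot_lmul_matrix inner_commute transpose_matrix_vector)

text \<open>Gram-Schmidt for the inner product defined by \<open>A\<close>. Being orthogonal to
  \<open>W\<close> in this sense means being orthogonal in the usual sense to the image of
  \<open>W\<close> under \<open>A\<close>, which spans a proper subspace while \<open>W\<close> has
  fewer than n elements; a nonzero vector orthogonal to it is then normalised.\<close>

lemma positive_definite_orthonormal_set:
  fixes A :: "real^'n^'n"
  assumes A: "positive_definite A" and "k \<le> CARD('n)"
  shows "\<exists>W. finite W \<and> card W = k \<and> (\<forall>v\<in>W. \<forall>w\<in>W. v \<bullet> (A *v w) = (if v = w then 1 else 0))"
  using \<open>k \<le> CARD('n)\<close>
proof (induction k)
  case 0
  show ?case by (rule exI[of _ "{}"]) simp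
next
  case (Suc k)
  then obtain W where W: "finite W" "card W = k"
    "\<And>v w. v \<in> W \<Longrightarrow> w \<in> W \<Longrightarrow> v \<bullet> (A *v w) = (if v = w then 1 else 0)"
    by auto
  have sym: "transpose A = A" and pos: "\<And>x. x \<noteq> 0 \<Longrightarrow> 0 < x \<bullet> (A *v x)"
    using A by (auto simp: positive_definite_def)
  have "dim ((*v) A ` W) \<le> card ((*v) A ` W)"
    using W(1) by (intro dim_le_card') simp
  also have "\<dots> < DIM(real^'n)"
    using card_image_le[OF W(1), of "(*v) A"] W(2) Suc.prems by simp
  finally obtain x where x: "x \<noteq> 0" "\<And>y. y \<in> span ((*v) A ` W) \<Longrightarrow> orthogonal x y"
    by (rule orthogonal_to_subspace_exists) blast
  define v where "v = (1 / sqrt (x \<bullet> (A *v x))) *\<^sub>R x"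
  have xW: "x \<bullet> (A *v w) = 0" if "w \<in> W" for w
    using x(2)[of "A *v w"] that by (auto simp: orthogonal_def intro: span_base)
  have vW: "v \<bullet> (A *v w) = 0" "w \<bullet> (A *v v) = 0" if "w \<in> W" for w
    using xW[OF that] inner_matrix_symmetric[OF sym, of w v] by (simp_all add: v_def)
  have vv: "v \<bullet> (A *v v) = 1"
    using pos[OF x(1)] by (simp add: v_def matrix_vector_mult_scaleR power2_eq_square[symmetric] less_imp_le)
  have "v \<notin> W" using vW vv by force
  then show ?case
    using W vW vv by (intro exI[of _ "insert v W"]) auto
qed

text \<open>The columns of \<open>B\<close> are a full \<open>A\<close>-orthonormal family. This
  \<open>B\<close> stands in for a square root of the inverse of \<open>A\<close>: it yields the
  sign of the determinant and the substitution that standardises a Gaussian.\<close>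

lemma positive_definite_congruent_mat_1:
  fixes A :: "real^'n^'n"
  assumes "positive_definite A"
  obtains B :: "real^'n^'n" where "transpose B ** A ** B = mat 1"
proof -
  obtain W where W: "finite W" "card W = CARD('n)"
    "\<And>v w. v \<in> W \<Longrightarrow> w \<in> W \<Longrightarrow> v \<bullet> (A *v w) = (if v = w then 1 else 0)"
    using positive_definite_orthonormal_set[OF assms, of "CARD('n)"] by auto
  obtain h where h: "bij_betw h (UNIV :: 'n set) W"
    using W by (metis finite_same_card_bij finite_class.finite_UNIV)
  define B :: "real^'n^'n" where "B = (\<chi> i j. h j $ i)"
  have "(transpose B ** A ** B) $ i $ j = h i \<bullet> (A *v h j)" for i j
    by (simp add: B_def matrix_matrix_mult_def transpose_def inner_vec_def matrix_vector_mult_def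
        sum_distrib_left sum_distrib_right mult.assoc) (rule sum.swap)
  moreover have "h i \<in> W" "h i = h j \<longleftrightarrow> i = j" for i j
    using h by (auto simp: bij_betw_def inj_on_eq_iff)
  ultimately have "transpose B ** A ** B = mat 1"
    unfolding vec_eq_iff[of "transpose B ** A ** B"] vec_eq_iff[of "_ $ _"] by (simp add: W(3) mat_def)
  then show ?thesis by (rule that)
qed

lemma det_positive_definite:
  fixes A :: "real^'n^'n"
  assumes "positive_definite A"
  shows "0 < det A"
proof -
  obtain B :: "real^'n^'n" where "transpose B ** A ** B = mat 1"
    using positive_definite_congruent_mat_1[OF assms] .
  then have "det (transpose B ** A ** B) = 1" by simp
  then have *: "det A * (det B)\<^sup>2 = 1"
    by (simp add: det_mul power2_eq_square mult_ac)
  then have "0 < (det B)\<^sup>2"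
    by (cases "det B = 0") auto
  with * show ?thesis
    using zero_less_mult_pos2[of "det A" "(det B)\<^sup>2"] by simp
qed

lemma matrix_inv_positive_definite:
  fixes A :: "real^'n^'n"
  assumes "positive_definite A"
  shows "A ** matrix_inv A = mat 1" "matrix_inv A ** A = mat 1"
proof -
  have "invertible A"
    using det_positive_definite[OF assms] by (simp add: invertible_det_nz)
  then obtain B where "A ** B = mat 1" "B ** A = mat 1"
    by (auto simp: invertible_def)
  then show "A ** matrix_inv A = mat 1" "matrix_inv A ** A = mat 1"
    by (simp_all add: matrix_inv_eqI)
qed

lemma positive_definite_matrix_inv:
  fixes A :: "real^'n^'n"
  assumes A: "positive_definite A"
  shows "positive_definite (matrix_inv A)"
proof -
  note inv = matrix_inv_positive_definite[OF A]
  have sym: "transpose A = A" and pos: "\<And>x. x \<noteq> 0 \<Longrightarrow> 0 < x \<bullet> (A *v x)"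
    using A by (auto simp: positive_definite_def)
  have "A ** transpose (matrix_inv A) = mat 1" "transpose (matrix_inv A) ** A = mat 1"
    using inv sym by (metis matrix_transpose_mul transpose_mat)+
  then have "matrix_inv A = transpose (matrix_inv A)"
    by (rule matrix_inv_eqI)
  moreover have "0 < x \<bullet> (matrix_inv A *v x)" if "x \<noteq> 0" for x
  proof -
    define y where "y = matrix_inv A *v x"
    have x: "x = A *v y"
      by (simp add: y_def matrix_vector_mul_assoc inv)
    with that have "y \<noteq> 0" by auto
    then show ?thesis
      using pos[of y] unfolding y_def[symmetric] by (simp add: x inner_commute)
  qed
  ultimately show ?thesis
    by (simp add: positive_definite_def)
qed

lemma positive_definite_scaleR:
  "0 < c \<Longrightarrow> positive_definite A \<Longrightarrow> positive_definite (c *\<^sub>R A)"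
  by (auto simp: positive_definite_def transpose_scalar scaleR_matrix_vector_assoc[symmetric])

lemma matrix_inv_scaleR:
  fixes A :: "real^'n^'n"
  assumes "positive_definite A" "c \<noteq> 0"
  shows "matrix_inv (c *\<^sub>R A) = (1 / c) *\<^sub>R matrix_inv A"
  using assms
  by (intro matrix_inv_eqI)
    (simp_all add: matrix_inv_positive_definite scalar_matrix_assoc[symmetric] matrix_scalar_ac)

lemma matrix_inv_matrix_inv:
  fixes A :: "real^'n^'n"
  assumes "positive_definite A"
  shows "matrix_inv (matrix_inv A) = A"
  using assms by (intro matrix_inv_eqI) (simp_all add: matrix_inv_positive_definite)

lemma positive_definite_mat_1: "positive_definite (mat 1)"
  by (simp add: positive_definite_def transpose_mat)

section \<open>Gaussian integrals\<close>

lemma nn_integral_exp_square_norm: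
  "(\<integral>\<^sup>+x. ennreal (exp (- (1/2) * (x \<bullet> x))) \<partial>(lborel :: (real^'n) measure))
    = ennreal (sqrt (2 * pi) ^ CARD('n))"
proof -
  have 1: "(\<integral>\<^sup>+t. ennreal (exp (- (1/2) * t\<^sup>2)) \<partial>lborel) = ennreal (sqrt (2 * pi))"
  proof -
    have "(\<integral>\<^sup>+t. ennreal (exp (- (1/2) * t\<^sup>2)) \<partial>lborel)
        = (\<integral>\<^sup>+t. ennreal (sqrt (2 * pi)) * ennreal (std_normal_density t) \<partial>lborel)"
      by (intro nn_integral_cong) (simp add: std_normal_density_def flip: ennreal_mult')
    also have "\<dots> = ennreal (sqrt (2 * pi)) * (\<integral>\<^sup>+t. ennreal (std_normal_density t) \<partial>lborel)"
      by (rule nn_integral_cmult) measurable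
    also have "(\<integral>\<^sup>+t. ennreal (std_normal_density t) \<partial>lborel) = 1"
      by (subst nn_integral_eq_integral) auto
    finally show ?thesis by simp
  qed
  have "(\<integral>\<^sup>+x. ennreal (exp (- (1/2) * (x \<bullet> x))) \<partial>(lborel :: (real^'n) measure))
      = (\<integral>\<^sup>+x. (\<Prod>b\<in>Basis. ennreal (exp (- (1/2) * (x \<bullet> b)\<^sup>2))) \<partial>(lborel :: (real^'n) measure))"
  proof (intro nn_integral_cong)
    fix x :: "real^'n"
    have "exp (- (1/2) * (x \<bullet> x)) = (\<Prod>b\<in>Basis. exp (- (1/2) * (x \<bullet> b)\<^sup>2))"
      by (subst euclidean_inner) (simp add: exp_sum[symmetric] sum_distrib_left power2_eq_square sum_negf sum_divide_distrib)
    then show "ennreal (exp (- (1/2) * (x \<bullet> x))) = (\<Prod>b\<in>Basis. ennreal (exp (- (1/2) * (x \<bullet> b)\<^sup>2)))"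
      by (simp add: prod_ennreal)
  qed
  also have "\<dots> = (\<Prod>b\<in>(Basis :: (real^'n) set). \<integral>\<^sup>+t. ennreal (exp (- (1/2) * t\<^sup>2)) \<partial>lborel)"
    by (rule nn_integral_lborel_prod) auto
  also have "\<dots> = ennreal (sqrt (2 * pi) ^ CARD('n))"
    unfolding 1 by (simp add: ennreal_power)
  finally show ?thesis .
qed

lemma nn_integral_lborel_translate:
  fixes F :: "'a::euclidean_space \<Rightarrow> ennreal"
  assumes [measurable]: "F \<in> borel_measurable borel"
  shows "(\<integral>\<^sup>+x. F (x - m) \<partial>lborel) = (\<integral>\<^sup>+x. F x \<partial>lborel)"
proof -
  have "(\<integral>\<^sup>+x. F x \<partial>lborel) = (\<integral>\<^sup>+x. F x \<partial>distr lborel borel ((+) (- m)))"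
    by (simp add: lborel_distr_plus)
  also have "\<dots> = (\<integral>\<^sup>+x. F (x - m) \<partial>lborel)"
    by (subst nn_integral_distr) auto
  finally show ?thesis ..
qed

lemma mvn_density_pos:
  assumes "positive_definite S"
  shows "0 < mvn_density m S x"
  using det_positive_definite[OF assms] by (simp add: mvn_density_def)

text \<open>Substitute x - m = B u, with \<open>B\<close> making the inverse covariance congruent to
  the identity. The exponent becomes -|u|^2/2, and the Jacobian |det B| equals sqrt (det S), which
  is the covariance factor of the normalising constant.\<close>

lemma prob_density_mvn_density:
  fixes S :: "real^'n^'n"
  assumes S: "positive_definite S"
  shows "prob_density (mvn_density m S)"
proof -
  let ?J = "matrix_inv S" and ?Z = "sqrt ((2 * pi) ^ CARD('n) * det S)"
  obtain B :: "real^'n^'n" where B: "transpose B ** ?J ** B = mat 1"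
    using positive_definite_congruent_mat_1[OF positive_definite_matrix_inv[OF S]] .
  have "det ?J * det S = 1"
    using matrix_inv_positive_definite(2)[OF S] by (metis det_I det_mul)
  moreover have "det ?J * (det B)\<^sup>2 = 1"
    using arg_cong[OF B, of det] by (simp add: det_mul power2_eq_square mult_ac)
  ultimately have detS: "det S = (det B)\<^sup>2" and B0: "det B \<noteq> 0"
    by (auto intro: mult_left_cancel[THEN iffD1, of "det ?J"])
  have quad: "(B *v x) \<bullet> (?J *v (B *v x)) = x \<bullet> x" for x
  proof -
    have "(B *v x) \<bullet> (?J *v (B *v x)) = x \<bullet> ((transpose B ** ?J ** B) *v x)"
      by (simp add: dot_lmul_matrix[symmetric] matrix_vector_mul_assoc[symmetric] transpose_matrix_vector inner_commute)
        (metis dot_lmul_matrix inner_commute)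
    then show ?thesis by (simp add: B)
  qed
  have Z: "0 < ?Z" using det_positive_definite[OF S] by simp
  have "(\<integral>\<^sup>+x. ennreal (mvn_density m S x) \<partial>lborel)
      = (\<integral>\<^sup>+x. ennreal (exp (- (1/2) * ((x - m) \<bullet> (?J *v (x - m))))) / ennreal ?Z \<partial>lborel)"
    using Z by (intro nn_integral_cong) (simp add: mvn_density_def divide_ennreal)
  also have "\<dots> = (\<integral>\<^sup>+x. ennreal (exp (- (1/2) * (x \<bullet> (?J *v x)))) / ennreal ?Z \<partial>lborel)"
    by (rule nn_integral_lborel_translate) measurable
  also have "\<dots> = (\<integral>\<^sup>+x. ennreal (exp (- (1/2) * (x \<bullet> (?J *v x)))) \<partial>lborel) / ennreal ?Z"
    by (rule nn_integral_divide) measurable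
  also have "(\<integral>\<^sup>+x. ennreal (exp (- (1/2) * (x \<bullet> (?J *v x)))) \<partial>lborel)
      = ennreal \<bar>det B\<bar> * (\<integral>\<^sup>+x. ennreal (exp (- (1/2) * (x \<bullet> x))) \<partial>(lborel :: (real^'n) measure))"
    by (subst nn_integral_lborel_matrix[OF B0, symmetric]) (measurable, simp add: quad)
  also have "\<dots> = ennreal ?Z"
  proof -
    have "?Z = \<bar>det B\<bar> * sqrt (2 * pi) ^ CARD('n)"
      unfolding detS real_sqrt_mult real_sqrt_power real_sqrt_abs
      by (metis mult.commute real_sqrt_abs real_sqrt_mult real_sqrt_power)
    then show ?thesis
      unfolding nn_integral_exp_square_norm by (subst ennreal_mult[symmetric]) auto
  qed
  also have "ennreal ?Z / ennreal ?Z = 1"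
    using divide_ennreal[OF less_imp_le[OF Z] Z] divide_self[of ?Z] Z by (metis ennreal_1 less_irrefl)
  finally show ?thesis
    using mvn_density_pos[OF S] by (simp add: prob_density_def less_imp_le)
qed

lemma prob_space_density:
  assumes "prob_density f"
  shows "prob_space (density lborel f)"
  using assms by (intro prob_spaceI) (simp add: prob_density_def emeasure_density)

lemma prob_density_integrable:
  assumes "prob_density f"
  shows "integrable lborel f" "(\<integral>x. f x \<partial>lborel) = 1"
proof -
  have "has_bochner_integral lborel f 1"
    using assms by (intro has_bochner_integral_nn_integral) (auto simp: prob_density_def)
  then show "integrable lborel f" "(\<integral>x. f x \<partial>lborel) = 1"
    by (auto simp: has_bochner_integral_iff)
qed

lemma integrable_mvn_density_quadratic:
  fixes S :: "real^'n^'n"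
  assumes S: "positive_definite S"
  shows "integrable lborel (\<lambda>x. mvn_density m S x * ((x - m) \<bullet> (matrix_inv S *v (x - m))))"
proof (rule Bochner_Integration.integrable_bound)
  \<comment> \<open>Doubling the covariance absorbs the quadratic factor, as $t e^{-t/2} \le 4 e^{-t/4}$.\<close>
  let ?S2 = "2 *\<^sub>R S" and ?Q = "\<lambda>x. (x - m) \<bullet> (matrix_inv S *v (x - m))"
  have S2: "positive_definite ?S2" using S by (simp add: positive_definite_scaleR)
  \<comment> \<open>The quotient of the two normalising constants: multiplying by \<open>C\<close>
    leaves exp (-Q/4) over the constant of the original density.\<close>
  define C where "C = sqrt (det ?S2 / det S)"
  have d: "0 < det S" "0 < det ?S2" using det_positive_definite S S2 by blast+
  show "integrable lborel (\<lambda>x. 4 * C * mvn_density m ?S2 x)"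
    using prob_density_integrable[OF prob_density_mvn_density[OF S2]] by simp
  have nonneg: "0 \<le> ?Q x" for x
    using positive_definite_matrix_inv[OF S]
    by (cases "x - m = 0") (auto simp: positive_definite_def less_imp_le)
  have inv2: "matrix_inv ?S2 = (1/2) *\<^sub>R matrix_inv S"
    using matrix_inv_scaleR[OF S, of 2] by simp
  have eq: "C * mvn_density m ?S2 x = exp (- (1/4) * ?Q x) / sqrt ((2 * pi) ^ CARD('n) * det S)" for x
    using d unfolding mvn_density_def inv2 C_def
    by (simp add: scaleR_matrix_vector_assoc[symmetric] real_sqrt_divide real_sqrt_mult)
  have key: "exp (- (1/2) * t) * t \<le> 4 * exp (- (1/4) * t)" if "0 \<le> t" for t :: real
  proof -
    have "t / 4 \<le> exp (t / 4)" using exp_ge_add_one_self[of "t / 4"] by linarith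
    then have "exp (- (1/2) * t) * t \<le> exp (- (1/2) * t) * (4 * exp (t / 4))"
      by (intro mult_left_mono) auto
    also have "\<dots> = 4 * exp (- (1/4) * t)"
      by (simp add: exp_add[symmetric])
    finally show ?thesis .
  qed
  show "AE x in lborel. norm (mvn_density m S x * ?Q x) \<le> norm (4 * C * mvn_density m ?S2 x)"
  proof (intro AE_I2)
    fix x
    have "mvn_density m S x * ?Q x
        = exp (- (1/2) * ?Q x) * ?Q x / sqrt ((2 * pi) ^ CARD('n) * det S)"
      by (simp add: mvn_density_def)
    also have "\<dots> \<le> 4 * exp (- (1/4) * ?Q x) / sqrt ((2 * pi) ^ CARD('n) * det S)"
      using d by (intro divide_right_mono key nonneg) auto
    also have "\<dots> = 4 * C * mvn_density m ?S2 x"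
      using eq[of x] by simp
    finally have "mvn_density m S x * ?Q x \<le> 4 * C * mvn_density m ?S2 x" .
    moreover have "0 \<le> mvn_density m S x * ?Q x"
      using nonneg mvn_density_pos[OF S, of m x] by simp
    ultimately show "norm (mvn_density m S x * ?Q x) \<le> norm (4 * C * mvn_density m ?S2 x)"
      unfolding real_norm_def by linarith
  qed
qed measurable

section \<open>Relative entropy\<close>

text \<open>Rewritten as an integral against \<open>P\<close>, the negative part has the integrand
  max 0 (-r ln r) with r the Radon-Nikodym derivative. It is at most 1 because ln (1/r) \<le> 1/r -
  1, and \<open>P\<close> has mass one.\<close>

lemma kl_div_neq_minus_infinity:
  assumes "prob_space P" and sets: "sets Q = sets P"
  shows "kl_div Q P \<noteq> - \<infinity>"
proof (cases "absolutely_continuous P Q")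
  case True
  interpret prob_space P by fact
  have Q: "Q = density P (RN_deriv P Q)"
    using density_RN_deriv[OF True sets] by simp
  let ?h = "entropy_density (exp 1) P Q"
  have [measurable]: "?h \<in> borel_measurable P"
    by (rule measurable_entropy_density)
  have le: "RN_deriv P Q x * ennreal (- ?h x) \<le> 1" for x
  proof (cases "RN_deriv P Q x")
    case (real r)
    then have h: "?h x = ln r" by (simp add: entropy_density_def log_def)
    show ?thesis
    proof (cases "r = 0")
      case False
      then have "ln (1 / r) \<le> 1 / r - 1" using real by (intro ln_le_minus_one) auto
      then have "r * - ln r \<le> r * (1 / r - 1)"
        using real False by (intro mult_left_mono) (auto simp: ln_div)
      also have "\<dots> \<le> 1" using real False by (simp add: algebra_simps)
      finally show ?thesis
        using real by (simp add: h ennreal_mult'[symmetric] ennreal_le_1)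
    qed (use real in simp)
  \<comment> \<open>Where the derivative is infinite, \<open>enn2real\<close> returns 0 and
    \<open>ln 0\<close> is 0, so the entropy density and with it the whole product vanish.\<close>
  qed (simp add: entropy_density_def log_def)
  have "(\<integral>\<^sup>+x. ennreal (- ?h x) \<partial>Q) = (\<integral>\<^sup>+x. ennreal (- ?h x) \<partial>density P (RN_deriv P Q))"
    using Q by simp
  also have "\<dots> = (\<integral>\<^sup>+x. RN_deriv P Q x * ennreal (- ?h x) \<partial>P)"
    by (rule nn_integral_density) measurable
  also have "\<dots> \<le> (\<integral>\<^sup>+x. 1 \<partial>P)"
    by (intro nn_integral_mono le)
  also have "\<dots> = 1" by (simp add: emeasure_space_1)
  finally have "(\<integral>\<^sup>+x. ennreal (- ?h x) \<partial>Q) \<noteq> \<infinity>" by (auto simp: top_unique)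
  then show ?thesis
    using True unfolding kl_div_def ext_integral_def
    by (cases "\<integral>\<^sup>+x. ennreal (?h x) \<partial>Q"; cases "\<integral>\<^sup>+x. ennreal (- ?h x) \<partial>Q") auto
qed (simp add: kl_div_def)

text \<open>An infinite positive part always gives \<open>\<infinity>\<close>, even against an
  infinite negative part, and an infinite negative part alone gives \<open>-\<infinity>\<close>. A
  finite value therefore leaves both parts finite.\<close>

lemma ext_integral_finite_imp_integrable:
  assumes f: "f \<in> borel_measurable M" and fin: "\<bar>ext_integral M f\<bar> \<noteq> \<infinity>"
  shows "integrable M f"
proof -
  let ?a = "\<integral>\<^sup>+x. ennreal (f x) \<partial>M" and ?b = "\<integral>\<^sup>+x. ennreal (- f x) \<partial>M"
  have "?a \<noteq> \<infinity>" "?b \<noteq> \<infinity>"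
    using fin unfolding ext_integral_def by (cases ?a; cases ?b; simp)+
  then show ?thesis
    using f by (simp add: real_integrable_def)
qed

text \<open>This is ln t \<le> t - 1, with equality only at t = 1, taken at t = q/r and multiplied
  by r. For r = 0 the expression is q, which is positive.\<close>

lemma gibbs_pointwise:
  fixes r q :: real
  assumes "0 \<le> r" "0 < q"
  shows "0 \<le> r * ln (r / q) - r + q" "r * ln (r / q) - r + q = 0 \<Longrightarrow> r = q"
proof -
  have "0 \<le> r * ln (r / q) - r + q \<and> (r * ln (r / q) - r + q = 0 \<longrightarrow> r = q)"
  proof (cases "r = 0")
    case False
    then have r: "0 < r" using assms by simp
    then have e: "r * ln (r / q) - r + q = r * ((q / r - 1) - ln (q / r))"
      using assms by (simp add: ln_div field_simps)
    have "ln (q / r) \<le> q / r - 1"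
      using r assms by (intro ln_le_minus_one) simp
    moreover have "q / r = 1" if "ln (q / r) = q / r - 1"
      using that r assms by (intro ln_eq_minus_one) auto
    ultimately show ?thesis
      unfolding e using r by auto
  qed (use assms in simp)
  then show "0 \<le> r * ln (r / q) - r + q" "r * ln (r / q) - r + q = 0 \<Longrightarrow> r = q" by auto
qed

text \<open>Adding q - r, whose integral is zero, makes the integrand nonnegative at every point, so
  a vanishing integral forces it to vanish almost everywhere.\<close>

lemma gibbs_inequality:
  assumes r: "prob_density r" and q: "prob_density q" "\<And>x. 0 < q x"
    and int: "integrable lborel (\<lambda>x. r x * ln (r x / q x))"
  shows "0 \<le> (\<integral>x. r x * ln (r x / q x) \<partial>lborel)"
    and "(\<integral>x. r x * ln (r x / q x) \<partial>lborel) = 0 \<Longrightarrow> AE x in lborel. r x = q x"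
proof -
  let ?d = "\<lambda>x. r x * ln (r x / q x) - r x + q x"
  note r' = prob_density_integrable[OF r] and q' = prob_density_integrable[OF q(1)]
  have r0: "0 \<le> r x" for x using r by (simp add: prob_density_def)
  have intd: "integrable lborel ?d" using int r' q' by simp
  have eq: "(\<integral>x. ?d x \<partial>lborel) = (\<integral>x. r x * ln (r x / q x) \<partial>lborel)"
    using int r' q' by simp
  show "0 \<le> (\<integral>x. r x * ln (r x / q x) \<partial>lborel)"
    unfolding eq[symmetric] by (intro Bochner_Integration.integral_nonneg gibbs_pointwise r0 q)
  assume "(\<integral>x. r x * ln (r x / q x) \<partial>lborel) = 0"
  then have "AE x in lborel. ?d x = 0"
    using integral_nonneg_eq_0_iff_AE[OF intd] gibbs_pointwise(1)[OF r0 q(2)] by (simp add: eq)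
  then show "AE x in lborel. r x = q x"
    by eventually_elim (rule gibbs_pointwise(2)[OF r0 q(2)])
qed

text \<open>The Gibbs variational principle: \<open>q\<close> is \<open>p\<close> tilted by exp g
  and renormalised, and \<open>c\<close> is the logarithm of the normalising constant.\<close>

lemma tilted_density_optimal:
  fixes r q p g :: "'a::euclidean_space \<Rightarrow> real"
  assumes r: "prob_density r" and q: "prob_density q" "\<And>x. 0 < q x"
    and p: "prob_density p" "\<And>x. 0 < p x"
    and g: "g \<in> borel_measurable borel" "\<And>x. g x \<le> b"
    and tilt: "\<And>x. g x + ln (p x) = c + ln (q x)"
  shows "ext_integral lborel (\<lambda>x. r x * g x) - kl_div (density lborel r) (density lborel p) \<le> ereal c"
    and "ext_integral lborel (\<lambda>x. r x * g x) - kl_div (density lborel r) (density lborel p) = ereal c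
      \<Longrightarrow> AE x in lborel. r x = q x"
proof -
  let ?E = "ext_integral lborel (\<lambda>x. r x * g x)"
    and ?K = "kl_div (density lborel r) (density lborel p)"
  have [measurable]: "r \<in> borel_measurable borel" "p \<in> borel_measurable borel" "g \<in> borel_measurable borel"
    using r p g by (simp_all add: prob_density_def)
  have r0: "0 \<le> r x" for x using r by (simp add: prob_density_def)
  have "?E \<noteq> \<infinity>"
  proof -
    \<comment> \<open>The upper bound \<open>b\<close> may be negative, whereas
      \<open>ennreal\<close> is multiplicative only on nonnegative factors; hence the absolute
      value.\<close>
    have "(\<integral>\<^sup>+x. ennreal (r x * g x) \<partial>lborel) \<le> (\<integral>\<^sup>+x. ennreal \<bar>b\<bar> * ennreal (r x) \<partial>lborel)"
    proof (intro nn_integral_mono)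
      fix x
      have "r x * g x \<le> r x * \<bar>b\<bar>"
        using g(2)[of x] r0[of x] by (intro mult_left_mono) auto
      then show "ennreal (r x * g x) \<le> ennreal \<bar>b\<bar> * ennreal (r x)"
        by (subst ennreal_mult[symmetric]) (auto simp: r0 mult.commute intro!: ennreal_leI)
    qed
    also have "\<dots> = ennreal \<bar>b\<bar> * (\<integral>\<^sup>+x. ennreal (r x) \<partial>lborel)"
      by (rule nn_integral_cmult) measurable
    also have "\<dots> < \<infinity>" using r by (simp add: prob_density_def)
    finally show ?thesis
      unfolding ext_integral_def
      by (cases "\<integral>\<^sup>+x. ennreal (r x * g x) \<partial>lborel"; cases "\<integral>\<^sup>+x. ennreal (- (r x * g x)) \<partial>lborel") auto
  qed
  have K: "?K = ext_integral lborel (\<lambda>x. r x * ln (r x / p x))"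
    by (rule kl_div_density) (auto simp: sigma_finite_lborel r0 p)
  have Km: "?K \<noteq> - \<infinity>"
    by (rule kl_div_neq_minus_infinity[OF prob_space_density[OF p(1)]]) simp
  have "?E - ?K \<le> ereal c \<and> (?E - ?K = ereal c \<longrightarrow> (AE x in lborel. r x = q x))"
  proof (cases "?K = \<infinity> \<or> ?E = - \<infinity>")
    case True
    then have "?E - ?K = - \<infinity>"
      using \<open>?E \<noteq> \<infinity>\<close> Km by (cases ?E; cases ?K) auto
    then show ?thesis by simp
  next
    case False
    then have iE: "integrable lborel (\<lambda>x. r x * g x)"
      using \<open>?E \<noteq> \<infinity>\<close> by (intro ext_integral_finite_imp_integrable) auto
    have iK: "integrable lborel (\<lambda>x. r x * ln (r x / p x))"
      using False Km unfolding K by (intro ext_integral_finite_imp_integrable) auto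
    \<comment> \<open>The logarithms of the quotients split only where r is positive; elsewhere the
      factor r x annihilates both sides.\<close>
    have h: "r x * ln (r x / q x) = c * r x - (r x * g x - r x * ln (r x / p x))" for x
    proof (cases "r x = 0")
      case False
      then have "ln (r x / q x) = ln (r x) - ln (q x)" "ln (r x / p x) = ln (r x) - ln (p x)"
        using p(2)[of x] q(2)[of x] r0[of x] by (simp_all add: ln_div)
      then have "ln (r x / q x) = c - (g x - ln (r x / p x))" using tilt[of x] by simp
      then have "r x * ln (r x / q x) = r x * (c - (g x - ln (r x / p x)))" by simp
      then show ?thesis by (simp only: right_diff_distrib mult.commute)
    qed simp
    have ih: "integrable lborel (\<lambda>x. r x * ln (r x / q x))"
      unfolding h using iE iK prob_density_integrable[OF r] by simp
    have "?E - ?K = ereal ((\<integral>x. r x * g x \<partial>lborel) - (\<integral>x. r x * ln (r x / p x) \<partial>lborel))"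
      unfolding K by (simp add: ext_integral_integrable iE iK)
    also have "\<dots> = ereal (c - (\<integral>x. r x * ln (r x / q x) \<partial>lborel))"
      unfolding h using iE iK prob_density_integrable[OF r] by simp
    finally show ?thesis
      using gibbs_inequality[OF r q ih] by auto
  qed
  then show "?E - ?K \<le> ereal c" "?E - ?K = ereal c \<Longrightarrow> AE x in lborel. r x = q x" by auto
qed

text \<open>At the optimum the tilt reads ln (q/p) = g - c, so integrability of g under
  \<open>q\<close> already makes the relative entropy finite.\<close>

lemma kl_div_tilted_density:
  fixes q p g :: "'a::euclidean_space \<Rightarrow> real"
  assumes q: "prob_density q" "\<And>x. 0 < q x" and p: "\<And>x. 0 < p x"
    and tilt: "\<And>x. g x + ln (p x) = c + ln (q x)"
    and int: "integrable lborel (\<lambda>x. q x * g x)"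
  shows "integrable lborel (\<lambda>x. q x * ln (q x / p x))"
    and "(\<integral>x. q x * ln (q x / p x) \<partial>lborel) = (\<integral>x. q x * g x \<partial>lborel) - c"
proof -
  have "q x * ln (q x / p x) = q x * g x - c * q x" for x
  proof -
    have "ln (q x / p x) = g x - c"
      using tilt[of x] q(2)[of x] p[of x] by (simp add: ln_div)
    then have "q x * ln (q x / p x) = q x * (g x - c)" by simp
    then show ?thesis by (simp only: right_diff_distrib mult.commute)
  qed
  then show "integrable lborel (\<lambda>x. q x * ln (q x / p x))"
    "(\<integral>x. q x * ln (q x / p x) \<partial>lborel) = (\<integral>x. q x * g x \<partial>lborel) - c"
    using int prob_density_integrable[OF q(1)] by simp_all
qed

section \<open>Independent columns of a matrix\<close>

lemma measurable_column_map [measurable]: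
  "(\<lambda>f::'d::finite \<Rightarrow> real^'m. \<chi> i d. f d $ i) \<in> (\<Pi>\<^sub>M d\<in>UNIV. lborel) \<rightarrow>\<^sub>M borel"
  by (intro borel_measurable_vec_lambda) measurable

text \<open>The type \<open>real^'d^'m\<close> is a vector of rows, so splitting it directly would
  give rows. Transposition permutes the standard basis and hence preserves Lebesgue measure.\<close>

lemma lborel_matrix_eq_columns:
  "(lborel :: (real^'d^'m) measure) = distr (\<Pi>\<^sub>M d\<in>UNIV. lborel) borel (\<lambda>f. \<chi> i d. f d $ i)"
proof -
  let ?T = "transpose :: real^'m^'d \<Rightarrow> real^'d^'m"
  have [measurable]: "?T \<in> borel \<rightarrow>\<^sub>M borel"
    unfolding transpose_def by (intro borel_measurable_vec_lambda) measurable
  have ax: "transpose (axis i (axis j 1)) = (axis j (axis i 1) :: real^'a^'b)" for i j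
    by (auto simp: transpose_def axis_def vec_eq_iff)
  have Basis: "(Basis :: (real^'a^'b) set) = {axis i (axis j 1) | i j. True}"
    by (auto simp: Basis_vec_def)
  have "distr lborel borel ?T = lborel"
  proof (rule lborel_distr_permute_Basis)
    show "bij_betw transpose (Basis :: (real^'d^'m) set) (Basis :: (real^'m^'d) set)"
      by (rule bij_betwI[of _ _ _ transpose]) (auto simp: Basis ax transpose_transpose, (blast intro: ax)+)
    show "?T x \<bullet> b = x \<bullet> transpose b" if "b \<in> Basis" for x b
      using that by (auto simp: Basis ax inner_axis) (simp add: transpose_def)
  qed measurable
  then have "lborel = distr (distr (\<Pi>\<^sub>M d\<in>UNIV. lborel) borel (\<lambda>f. \<chi> d. f d)) borel ?T"
    by (simp flip: lborel_vec_eq)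
  also have "\<dots> = distr (\<Pi>\<^sub>M d\<in>UNIV. lborel) borel (?T \<circ> (\<lambda>f. \<chi> d. f d))"
    by (rule distr_distr) measurable
  finally show ?thesis
    by (simp add: o_def transpose_def)
qed

lemma column_measurable [measurable]:
  "column d \<in> borel_measurable (borel :: (real^'d^'m) measure)"
  unfolding column_def by (intro borel_measurable_vec_lambda) measurable

lemma lborel_prod_columns:
  fixes f :: "'d::finite \<Rightarrow> real^'m \<Rightarrow> real"
  assumes int: "\<And>d. integrable lborel (f d)"
  shows "integrable lborel (\<lambda>A::real^'d^'m. \<Prod>d\<in>UNIV. f d (column d A))"
    and "(\<integral>A. (\<Prod>d\<in>UNIV. f d (column d A)) \<partial>(lborel :: (real^'d^'m) measure))
      = (\<Prod>d\<in>UNIV. \<integral>x. f d x \<partial>lborel)"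
proof -
  interpret product_sigma_finite "\<lambda>_::'d. lborel :: (real^'m) measure"
    by standard
  have [measurable]: "f d \<in> borel_measurable borel" for d
    using borel_measurable_integrable[OF int[of d]] by simp
  have col: "column d (\<chi> i d. g d $ i) = g d" for d and g :: "'d \<Rightarrow> real^'m"
    by (simp add: column_def vec_eq_iff)
  show "integrable lborel (\<lambda>A::real^'d^'m. \<Prod>d\<in>UNIV. f d (column d A))"
    by (subst lborel_matrix_eq_columns, subst integrable_distr_eq)
      (auto simp: col intro!: product_integrable_prod int)
  show "(\<integral>A. (\<Prod>d\<in>UNIV. f d (column d A)) \<partial>(lborel :: (real^'d^'m) measure))
      = (\<Prod>d\<in>UNIV. \<integral>x. f d x \<partial>lborel)"
    by (subst lborel_matrix_eq_columns, subst integral_distr)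
      (auto simp: col intro!: product_integral_prod int)
qed

lemma kl_div_prod_columns:
  fixes q p :: "'d::finite \<Rightarrow> real^'m \<Rightarrow> real"
  assumes q: "\<And>d. prob_density (q d)" "\<And>d x. 0 < q d x"
    and p: "\<And>d. prob_density (p d)" "\<And>d x. 0 < p d x"
    and int: "\<And>d. integrable lborel (\<lambda>x. q d x * ln (q d x / p d x))"
  shows "kl_div (density lborel (\<lambda>A::real^'d^'m. \<Prod>d\<in>UNIV. q d (column d A)))
      (density lborel (\<lambda>A::real^'d^'m. \<Prod>d\<in>UNIV. p d (column d A)))
    = ereal (\<Sum>d\<in>UNIV. \<integral>x. q d x * ln (q d x / p d x) \<partial>lborel)"
proof -
  have [measurable]: "q d \<in> borel_measurable borel" "p d \<in> borel_measurable borel" for d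
    using q p by (simp_all add: prob_density_def)
  \<comment> \<open>\<open>h d\<close> keeps the densities in all factors except factor
    \<open>d\<close>, which carries the entropy integrand. Each term of the expanded logarithm is
    thus again a product over columns, in which the other factors integrate to one.\<close>
  define h where "h d e = (if e = d then (\<lambda>x. q d x * ln (q d x / p d x)) else q e)" for d e
  have ih: "integrable lborel (h d e)" for d e
    using int prob_density_integrable(1)[OF q(1)] by (simp add: h_def)
  have split: "(\<Prod>e\<in>UNIV. h d e (y e)) = (\<Prod>e\<in>UNIV. q e (y e)) * ln (q d (y d) / p d (y d))" for d and y :: "'d \<Rightarrow> real^'m"
  proof -
    have "(\<Prod>e\<in>UNIV - {d}. h d e (y e)) = (\<Prod>e\<in>UNIV - {d}. q e (y e))"
      by (intro prod.cong) (auto simp: h_def)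
    then show ?thesis
      by (simp add: prod.remove[of UNIV d] h_def)
  qed
  have sum: "(\<Prod>d\<in>UNIV. q d (y d)) * ln ((\<Prod>d\<in>UNIV. q d (y d)) / (\<Prod>d\<in>UNIV. p d (y d)))
      = (\<Sum>d\<in>UNIV. \<Prod>e\<in>UNIV. h d e (y e))" for y :: "'d \<Rightarrow> real^'m"
  proof -
    have "ln ((\<Prod>d\<in>UNIV. q d (y d)) / (\<Prod>d\<in>UNIV. p d (y d))) = ln (\<Prod>d\<in>UNIV. q d (y d) / p d (y d))"
      by (simp add: prod_dividef)
    also have "\<dots> = (\<Sum>d\<in>UNIV. ln (q d (y d) / p d (y d)))"
      by (intro ln_prod) (simp_all add: less_imp_neq[OF q(2), symmetric] less_imp_neq[OF p(2), symmetric] q p)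
    finally show ?thesis
      by (simp add: split sum_distrib_left)
  qed
  have "(\<Prod>e\<in>UNIV. \<integral>x. h d e x \<partial>lborel) = (\<integral>x. q d x * ln (q d x / p d x) \<partial>lborel)" for d
  proof -
    have "(\<Prod>e\<in>UNIV - {d}. \<integral>x. h d e x \<partial>lborel) = 1"
      using prob_density_integrable(2)[OF q(1)] by (intro prod.neutral) (auto simp: h_def)
    then show ?thesis
      by (simp add: prod.remove[of UNIV d]) (simp add: h_def)
  qed
  moreover have "kl_div (density lborel (\<lambda>A::real^'d^'m. \<Prod>d\<in>UNIV. q d (column d A)))
      (density lborel (\<lambda>A::real^'d^'m. \<Prod>d\<in>UNIV. p d (column d A)))
    = ext_integral lborel (\<lambda>A::real^'d^'m. \<Sum>d\<in>UNIV. \<Prod>e\<in>UNIV. h d e (column e A))"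
    unfolding sum[symmetric]
    by (intro kl_div_density)
      (auto simp: sigma_finite_lborel intro!: prod_pos prod_nonneg q p less_imp_le)
  ultimately show ?thesis
    using lborel_prod_columns[of "h d" for d, OF ih]
    by (simp add: ext_integral_integrable)
qed

section \<open>The variational bound\<close>

lemma ln_mvn_density:
  fixes S :: "real^'n^'n"
  assumes "positive_definite S"
  shows "ln (mvn_density m S x) =
    - (1/2) * ((x - m) \<bullet> (matrix_inv S *v (x - m))) - real CARD('n) / 2 * ln (2 * pi) - 1/2 * ln (det S)"
proof -
  have d: "0 < det S" by (rule det_positive_definite[OF assms])
  have "ln (sqrt ((2 * pi) ^ CARD('n) * det S)) = (real CARD('n) * ln (2 * pi) + ln (det S)) / 2"
    using d by (simp add: ln_sqrt ln_mult_pos ln_realpow algebra_simps del: power_mult_distrib)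
  then show ?thesis
    unfolding mvn_density_def using d by (simp add: ln_div)
qed

lemma ln_likelihood:
  fixes \<Phi> :: "real^'m^'n"
  assumes "0 < \<tau>"
  shows "ln (likelihood \<tau> \<Phi> a y) =
    - (real CARD('n) / 2) * ln (2 * pi * (1 / \<tau>)) - \<tau> / 2 * ((y - \<Phi> *v a) \<bullet> (y - \<Phi> *v a))"
proof -
  let ?S = "(1 / \<tau>) *\<^sub>R mat 1 :: real^'n^'n"
  have S: "positive_definite ?S"
    using assms by (intro positive_definite_scaleR positive_definite_mat_1) simp
  have "det ?S = (1 / \<tau>) ^ CARD('n)"
    by (subst det_diagonal) (simp_all add: mat_def)
  then have "ln (det ?S) = real CARD('n) * ln (1 / \<tau>)"
    using assms by (simp add: ln_realpow del: power_one_over)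
  moreover have "matrix_inv ?S = \<tau> *\<^sub>R mat 1"
    using assms by (intro matrix_inv_eqI) (simp_all add: scalar_matrix_assoc[symmetric] matrix_scalar_ac)
  moreover have "ln (2 * pi * (1 / \<tau>)) = ln (2 * pi) + ln (1 / \<tau>)"
    using assms by (intro ln_mult_pos) auto
  ultimately show ?thesis
    unfolding likelihood_def ln_mvn_density[OF S]
    by (simp add: scaleR_matrix_vector_assoc[symmetric] algebra_simps)
qed

text \<open>A bilinear form is a finite linear combination of the matrix entries, so entrywise
  integrability passes to it.\<close>

lemma bilinear_matrix_expectation:
  fixes F :: "'w \<Rightarrow> real^'m^'n"
  assumes int: "\<And>i j. integrable Q (\<lambda>\<omega>. F \<omega> $ i $ j)"
  shows "integrable Q (\<lambda>\<omega>. x \<bullet> (F \<omega> *v z))"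
    and "(\<integral>\<omega>. x \<bullet> (F \<omega> *v z) \<partial>Q) = x \<bullet> (matrix_expectation Q F *v z)"
proof -
  have eq: "x \<bullet> (A *v z) = (\<Sum>i\<in>UNIV. \<Sum>j\<in>UNIV. x $ i * z $ j * A $ i $ j)" for A :: "real^'m^'n"
    by (simp add: inner_vec_def matrix_vector_mult_def sum_distrib_left mult_ac)
  show "integrable Q (\<lambda>\<omega>. x \<bullet> (F \<omega> *v z))"
    unfolding eq by (intro Bochner_Integration.integrable_sum integrable_mult_right int)
  show "(\<integral>\<omega>. x \<bullet> (F \<omega> *v z) \<partial>Q) = x \<bullet> (matrix_expectation Q F *v z)"
    unfolding eq using int by (simp add: Bochner_Integration.integral_sum matrix_expectation_def)
qed

lemma matrix_expectation_transpose:
  "matrix_expectation Q (\<lambda>\<omega>. transpose (F \<omega>)) = transpose (matrix_expectation Q F)"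
  by (simp add: matrix_expectation_def transpose_def)

lemma inner_residual_expand:
  "(y - A *v a) \<bullet> (y - A *v a) = y \<bullet> y - 2 * (y \<bullet> (A *v a)) + a \<bullet> ((transpose A ** A) *v a)"
  for A :: "real^'m^'n" and y :: "real^'n"
proof -
  have "(A *v a) \<bullet> (A *v a) = a \<bullet> ((transpose A ** A) *v a)"
    by (metis dot_lmul_matrix inner_commute matrix_vector_mul_assoc transpose_matrix_vector)
  then show ?thesis
    by (simp add: inner_diff_left inner_diff_right inner_commute)
qed

text \<open>Only the first and second moments of the features enter the bound in a, so the
  trigonometric form of \<Phi> is abstracted to integrability of the entries and of their Gram
  matrix.\<close>

locale random_features = prob_space Q for Q :: "'w measure" +
  fixes \<Phi> :: "'w \<Rightarrow> real^'m^'n" and \<tau> :: real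
  assumes \<tau>: "0 < \<tau>"
    and int1: "\<And>i j. integrable Q (\<lambda>\<omega>. \<Phi> \<omega> $ i $ j)"
    and int2: "\<And>i j. integrable Q (\<lambda>\<omega>. (transpose (\<Phi> \<omega>) ** \<Phi> \<omega>) $ i $ j)"
begin

definition "mean_feat = matrix_expectation Q \<Phi>"

definition "gram = matrix_expectation Q (\<lambda>\<omega>. transpose (\<Phi> \<omega>) ** \<Phi> \<omega>)"

text \<open>This is the matrix \<Sigma> of the theorem; the covariance is \<open>post_cov\<close>.
  Together with \<open>post_mean\<close> it forms the posterior of Bayesian linear regression, with
  \<Phi> and its Gram matrix replaced by their means.\<close>

definition "post_matrix = matrix_inv (gram + (1 / \<tau>) *\<^sub>R mat 1)"

definition "post_mean y = post_matrix *v (transpose mean_feat *v y)"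

definition "post_cov = (1 / \<tau>) *\<^sub>R post_matrix"

definition "mean_loglik y a = (\<integral>\<omega>. ln (likelihood \<tau> (\<Phi> \<omega>) a y) \<partial>Q)"

text \<open>The logarithm of the integral of the prior density times exp of
  \<open>mean_loglik y\<close>. The determinant is the ratio of the normalising constants of
  posterior and prior; the last summand is half the quadratic form of the precision at
  \<open>post_mean y\<close>, left over by completing the square.\<close>

definition "column_optimum y =
  - (real CARD('n) / 2) * ln (2 * pi * (1 / \<tau>)) - \<tau> / 2 * (y \<bullet> y)
  + 1 / 2 * ln (det post_cov) + 1 / 2 * \<tau> * (y \<bullet> (mean_feat *v post_mean y))"

section \<open>The expected log-likelihood as a quadratic function\<close>

lemma residual_expectation:
  "integrable Q (\<lambda>\<omega>. (y - \<Phi> \<omega> *v a) \<bullet> (y - \<Phi> \<omega> *v a))"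
  "(\<integral>\<omega>. (y - \<Phi> \<omega> *v a) \<bullet> (y - \<Phi> \<omega> *v a) \<partial>Q)
    = y \<bullet> y - 2 * (y \<bullet> (mean_feat *v a)) + a \<bullet> (gram *v a)"
  unfolding inner_residual_expand mean_feat_def gram_def
  using bilinear_matrix_expectation[OF int1] bilinear_matrix_expectation[OF int2]
  by (simp_all add: prob_space)

text \<open>The square is kept whole here, since its sign gives the upper bound; the expanded form
  serves for completing the square.\<close>

lemma mean_loglik_residual:
  "mean_loglik y a = - (real CARD('n) / 2) * ln (2 * pi * (1 / \<tau>))
    - \<tau> / 2 * (\<integral>\<omega>. (y - \<Phi> \<omega> *v a) \<bullet> (y - \<Phi> \<omega> *v a) \<partial>Q)"
  unfolding mean_loglik_def ln_likelihood[OF \<tau>] using residual_expectation(1)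
  by (simp add: prob_space)

lemma mean_loglik_quadratic:
  "mean_loglik y a = - (real CARD('n) / 2) * ln (2 * pi * (1 / \<tau>))
    - \<tau> / 2 * (y \<bullet> y - 2 * (y \<bullet> (mean_feat *v a)) + a \<bullet> (gram *v a))"
  by (simp add: mean_loglik_residual residual_expectation)

lemma mean_loglik_le: "mean_loglik y a \<le> - (real CARD('n) / 2) * ln (2 * pi * (1 / \<tau>))"
proof -
  have "0 \<le> (\<integral>\<omega>. (y - \<Phi> \<omega> *v a) \<bullet> (y - \<Phi> \<omega> *v a) \<partial>Q)"
    by (intro Bochner_Integration.integral_nonneg) simp
  then show ?thesis
    using \<tau> by (simp add: mean_loglik_residual)
qed

lemma mean_loglik_measurable [measurable]: "mean_loglik y \<in> borel_measurable borel"
proof -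
  have "(\<lambda>a. a \<bullet> (gram *v a)) \<in> borel_measurable borel" "(\<lambda>a. y \<bullet> (mean_feat *v a)) \<in> borel_measurable borel"
    by measurable
  then show ?thesis
    unfolding mean_loglik_quadratic[abs_def] by measurable
qed

lemma gram_symmetric: "transpose gram = gram"
proof -
  have "(transpose (\<Phi> \<omega>) ** \<Phi> \<omega>) $ j $ i = (transpose (\<Phi> \<omega>) ** \<Phi> \<omega>) $ i $ j" for \<omega> i j
    by (simp add: matrix_matrix_mult_def transpose_def mult.commute)
  then show ?thesis
    by (simp add: gram_def matrix_expectation_def transpose_def[of "vec_lambda _"])
qed

text \<open>The form is the expectation of |\<Phi> a|^2, that is, the expected squared residual at y
  = 0.\<close>

lemma gram_nonneg: "0 \<le> a \<bullet> (gram *v a)"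
proof -
  have "0 \<le> (\<integral>\<omega>. (0 - \<Phi> \<omega> *v a) \<bullet> (0 - \<Phi> \<omega> *v a) \<partial>Q)"
    by (intro Bochner_Integration.integral_nonneg) simp
  then show ?thesis
    unfolding residual_expectation by simp
qed

lemma precision_positive_definite: "positive_definite (gram + (1 / \<tau>) *\<^sub>R mat 1)"
proof -
  have "transpose (gram + (1 / \<tau>) *\<^sub>R mat 1) = gram + (1 / \<tau>) *\<^sub>R mat 1"
    using gram_symmetric by (simp add: transpose_def vec_eq_iff mat_def)
  moreover have "0 < x \<bullet> ((gram + (1 / \<tau>) *\<^sub>R mat 1) *v x)" if "x \<noteq> 0" for x
    using that \<tau> gram_nonneg[of x]
    by (simp add: matrix_vector_mult_add_rdistrib inner_add_right scaleR_matrix_vector_assoc[symmetric] add_nonneg_pos)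
  ultimately show ?thesis by (simp add: positive_definite_def)
qed

lemma post_cov_positive_definite: "positive_definite post_cov"
  unfolding post_cov_def post_matrix_def using \<tau>
  by (intro positive_definite_scaleR positive_definite_matrix_inv precision_positive_definite) simp

lemma matrix_inv_post_cov: "matrix_inv post_cov = \<tau> *\<^sub>R gram + mat 1"
proof -
  have "matrix_inv post_cov = \<tau> *\<^sub>R (gram + (1 / \<tau>) *\<^sub>R mat 1)"
    unfolding post_cov_def post_matrix_def using \<tau>
    by (subst matrix_inv_scaleR)
      (simp_all add: positive_definite_matrix_inv precision_positive_definite matrix_inv_matrix_inv)
  then show ?thesis
    using \<tau> by (simp add: scaleR_add_right)
qed

text \<open>The normal equation: the precision cancels \<Sigma> in the mean and leaves the linear
  coefficient of the expected log-likelihood.\<close>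

lemma matrix_inv_post_cov_mean:
  "matrix_inv post_cov *v post_mean y = \<tau> *\<^sub>R (transpose mean_feat *v y)"
proof -
  have "(gram + (1 / \<tau>) *\<^sub>R mat 1) *v post_mean y = transpose mean_feat *v y"
    unfolding post_mean_def post_matrix_def
    by (simp add: matrix_vector_mul_assoc matrix_inv_positive_definite precision_positive_definite)
  moreover have "matrix_inv post_cov = \<tau> *\<^sub>R (gram + (1 / \<tau>) *\<^sub>R mat 1)"
    using \<tau> by (simp add: matrix_inv_post_cov scaleR_add_right)
  ultimately show ?thesis
    by (simp add: scaleR_matrix_vector_assoc[symmetric])
qed

text \<open>The quadratic terms agree because the precision is \<tau> times \<open>gram\<close> plus
  the prior precision, the linear terms by the normal equation, and the powers of 2 pi cancel
  because prior and posterior live in the same dimension.\<close>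

lemma complete_square:
  "mean_loglik y a + ln (mvn_density 0 (mat 1) a) = column_optimum y + ln (mvn_density (post_mean y) post_cov a)"
proof -
  let ?J = "matrix_inv post_cov" and ?m = "post_mean y"
  have sym: "transpose ?J = ?J"
    using positive_definite_matrix_inv[OF post_cov_positive_definite] by (simp add: positive_definite_def)
  have inv1: "matrix_inv (mat 1 :: real^'m^'m) = mat 1"
    by (rule matrix_inv_eqI) simp_all
  have adj: "b \<bullet> (transpose mean_feat *v y) = y \<bullet> (mean_feat *v b)" for b
    by (metis dot_lmul_matrix inner_commute transpose_matrix_vector)
  have Jm: "b \<bullet> (?J *v ?m) = \<tau> * (y \<bullet> (mean_feat *v b))" for b
    by (simp only: matrix_inv_post_cov_mean inner_scaleR_right adj)
  have "(a - ?m) \<bullet> (?J *v (a - ?m)) = a \<bullet> (?J *v a) - 2 * (a \<bullet> (?J *v ?m)) + ?m \<bullet> (?J *v ?m)"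
    using inner_matrix_symmetric[OF sym, of ?m a]
    by (simp add: matrix_vector_mult_diff_distrib inner_diff_left inner_diff_right)
  also have "a \<bullet> (?J *v a) = \<tau> * (a \<bullet> (gram *v a)) + a \<bullet> a"
    by (simp add: matrix_inv_post_cov matrix_vector_mult_add_rdistrib inner_add_right scaleR_matrix_vector_assoc[symmetric])
  finally show ?thesis
    unfolding ln_mvn_density[OF post_cov_positive_definite] ln_mvn_density[OF positive_definite_mat_1]
      mean_loglik_quadratic column_optimum_def Jm inv1
    by (simp add: algebra_simps)
qed

text \<open>The posterior is no wider than the prior. This lets |a|^2 be controlled by the quadratic
  form of the posterior density itself.\<close>

lemma post_cov_dominates: "x \<bullet> x \<le> x \<bullet> (matrix_inv post_cov *v x)"
  using gram_nonneg[of x] \<tau>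
  by (simp add: matrix_inv_post_cov matrix_vector_mult_add_rdistrib inner_add_right scaleR_matrix_vector_assoc[symmetric])

lemma integrable_post_loglik:
  "integrable lborel (\<lambda>a. mvn_density (post_mean y) post_cov a * mean_loglik y a)"
proof -
  let ?m = "post_mean y" and ?q = "mvn_density (post_mean y) post_cov"
  let ?Q = "\<lambda>a. (a - ?m) \<bullet> (matrix_inv post_cov *v (a - ?m))"
  have q: "0 < ?q a" for a by (rule mvn_density_pos[OF post_cov_positive_definite])
  have iq: "integrable lborel ?q"
    by (rule prob_density_integrable[OF prob_density_mvn_density[OF post_cov_positive_definite]])
  have iQ: "integrable lborel (\<lambda>a. ?q a * ?Q a)"
    by (rule integrable_mvn_density_quadratic[OF post_cov_positive_definite])
  have i2: "integrable lborel (\<lambda>a. ?q a * (a \<bullet> a))"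
  proof (rule Bochner_Integration.integrable_bound)
    show "integrable lborel (\<lambda>a. 2 * (?q a * ?Q a) + 2 * (?m \<bullet> ?m) * ?q a)"
      using iq iQ by simp
    show "AE a in lborel. norm (?q a * (a \<bullet> a)) \<le> norm (2 * (?q a * ?Q a) + 2 * (?m \<bullet> ?m) * ?q a)"
    proof (intro AE_I2)
      fix a
      \<comment> \<open>The gap in the next inequality, 2|a - m|^2 + 2|m|^2 - |a|^2, is exactly |a -
        2m|^2.\<close>
      have "0 \<le> (a - 2 *\<^sub>R ?m) \<bullet> (a - 2 *\<^sub>R ?m)" by simp
      then have "a \<bullet> a \<le> 2 * ((a - ?m) \<bullet> (a - ?m)) + 2 * (?m \<bullet> ?m)"
        by (simp add: inner_diff_left inner_diff_right inner_commute)
      also have "\<dots> \<le> 2 * ?Q a + 2 * (?m \<bullet> ?m)"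
        using post_cov_dominates[of "a - ?m"] by simp
      finally have "?q a * (a \<bullet> a) \<le> ?q a * (2 * ?Q a + 2 * (?m \<bullet> ?m))"
        using q[of a] by (intro mult_left_mono) auto
      also have "\<dots> = 2 * (?q a * ?Q a) + 2 * (?m \<bullet> ?m) * ?q a"
        by (simp only: distrib_left mult_ac)
      finally have "?q a * (a \<bullet> a) \<le> 2 * (?q a * ?Q a) + 2 * (?m \<bullet> ?m) * ?q a" .
      moreover have "0 \<le> ?q a * (a \<bullet> a)" using q[of a] by simp
      ultimately show "norm (?q a * (a \<bullet> a)) \<le> norm (2 * (?q a * ?Q a) + 2 * (?m \<bullet> ?m) * ?q a)"
        unfolding real_norm_def by linarith
    qed
  qed measurable
  have inv1: "matrix_inv (mat 1 :: real^'m^'m) = mat 1"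
    by (rule matrix_inv_eqI) simp_all
  \<comment> \<open>Reading the completed square backwards expresses \<open>mean_loglik\<close>
    through 1, the quadratic form of the density and |a|^2, all of which are integrable by now; no
    mixed terms have to be estimated.\<close>
  have eq: "?q a * mean_loglik y a
    = (column_optimum y - 1/2 * ln (det post_cov)) * ?q a - 1/2 * (?q a * ?Q a) + 1/2 * (?q a * (a \<bullet> a))" for a
  proof -
    have "mean_loglik y a = column_optimum y - 1/2 * ln (det post_cov) - 1/2 * ?Q a + 1/2 * (a \<bullet> a)"
      using complete_square[of y a]
      unfolding ln_mvn_density[OF post_cov_positive_definite] ln_mvn_density[OF positive_definite_mat_1] inv1
      by simp
    then show ?thesis by (simp only:) (simp only: distrib_left right_diff_distrib mult_ac)
  qed
  show ?thesis
    unfolding eq using iq iQ i2 by simp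
qed

section \<open>Optimal value and optimality\<close>

lemma post_density:
  "prob_density (mvn_density (post_mean y) post_cov)" "0 < mvn_density (post_mean y) post_cov a"
  by (auto intro: prob_density_mvn_density mvn_density_pos post_cov_positive_definite)

lemma expected_loglik_eq: "expected_loglik Q \<tau> \<Phi> y r = ext_integral lborel (\<lambda>a. r a * mean_loglik y a)"
  by (simp add: expected_loglik_def mean_loglik_def)

text \<open>The entropy integral is left unevaluated: it appears here with a plus sign and is
  cancelled by the relative entropy, both for one column and for the full matrix.\<close>

lemma kl_post:
  defines "q \<equiv> \<lambda>y. mvn_density (post_mean y) post_cov"
  shows "integrable lborel (\<lambda>a. q y a * ln (q y a / mvn_density 0 (mat 1) a))"
    and "expected_loglik Q \<tau> \<Phi> y (q y) =
      ereal (column_optimum y + (\<integral>a. q y a * ln (q y a / mvn_density 0 (mat 1) a) \<partial>lborel))"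
proof -
  note kl = kl_div_tilted_density[OF post_density mvn_density_pos[OF positive_definite_mat_1]
      complete_square integrable_post_loglik]
  show "integrable lborel (\<lambda>a. q y a * ln (q y a / mvn_density 0 (mat 1) a))"
    unfolding q_def by (rule kl)
  show "expected_loglik Q \<tau> \<Phi> y (q y) =
      ereal (column_optimum y + (\<integral>a. q y a * ln (q y a / mvn_density 0 (mat 1) a) \<partial>lborel))"
    unfolding q_def expected_loglik_eq ext_integral_integrable[OF integrable_post_loglik] kl by simp
qed

lemma column_bound_post:
  "column_bound Q P \<tau> \<Phi> y (mvn_density (post_mean y) post_cov) = ereal (column_optimum y) - kl_div Q P"
proof -
  let ?q = "mvn_density (post_mean y) post_cov"
  have "kl_div (density lborel ?q) (density lborel (mvn_density 0 (mat 1)))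
      = ereal (\<integral>a. ?q a * ln (?q a / mvn_density 0 (mat 1) a) \<partial>lborel)"
    using post_density mvn_density_pos[OF positive_definite_mat_1] kl_post(1)
    by (subst kl_div_density) (auto simp: sigma_finite_lborel less_imp_le ext_integral_integrable)
  then show ?thesis
    unfolding column_bound_def kl_post(2) by simp
qed

text \<open>KL(q(\<omega>) || p(\<omega>)) is the same for all \<open>r\<close>; being finite, it
  can be cancelled from the equality of two bounds, which returns the question to the equality case
  of Gibbs.\<close>

lemma column_bound_optimal:
  assumes r: "prob_density r" and K: "\<bar>kl_div Q P\<bar> \<noteq> \<infinity>"
  shows "column_bound Q P \<tau> \<Phi> y r \<le> column_bound Q P \<tau> \<Phi> y (mvn_density (post_mean y) post_cov)"
    and "column_bound Q P \<tau> \<Phi> y r = column_bound Q P \<tau> \<Phi> y (mvn_density (post_mean y) post_cov)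
      \<Longrightarrow> AE a in lborel. r a = mvn_density (post_mean y) post_cov a"
proof -
  note opt = tilted_density_optimal[OF r post_density prob_density_mvn_density[OF positive_definite_mat_1]
      mvn_density_pos[OF positive_definite_mat_1] mean_loglik_measurable mean_loglik_le complete_square,
      folded expected_loglik_eq]
  obtain k where k: "kl_div Q P = ereal k" using K by (cases "kl_div Q P") auto
  show "column_bound Q P \<tau> \<Phi> y r \<le> column_bound Q P \<tau> \<Phi> y (mvn_density (post_mean y) post_cov)"
    unfolding column_bound_post unfolding column_bound_def by (intro ereal_minus_mono opt order_refl)
  assume "column_bound Q P \<tau> \<Phi> y r = column_bound Q P \<tau> \<Phi> y (mvn_density (post_mean y) post_cov)"
  then have "expected_loglik Q \<tau> \<Phi> y r - kl_div (density lborel r) (density lborel (mvn_density 0 (mat 1)))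
      = ereal (column_optimum y)"
    unfolding column_bound_post unfolding column_bound_def k
    by (cases "expected_loglik Q \<tau> \<Phi> y r - kl_div (density lborel r) (density lborel (mvn_density 0 (mat 1)))") auto
  then show "AE a in lborel. r a = mvn_density (post_mean y) post_cov a"
    by (rule opt(2))
qed

text \<open>The entropy terms cancel column by column. KL(q(\<omega>) || p(\<omega>)) is subtracted
  once, because all columns share the same \<omega>.\<close>

lemma lower_bound_post:
  fixes Y :: "real^'d^'n"
  shows "lower_bound Q P \<tau> \<Phi> Y (\<lambda>d. mvn_density (post_mean (column d Y)) post_cov)
    = ereal (\<Sum>d\<in>UNIV. column_optimum (column d Y)) - kl_div Q P"
proof -
  have "kl_div (density lborel (\<lambda>A::real^'d^'m. \<Prod>d\<in>UNIV. mvn_density (post_mean (column d Y)) post_cov (column d A)))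
      (density lborel (\<lambda>A::real^'d^'m. \<Prod>d\<in>UNIV. mvn_density 0 (mat 1) (column d A)))
    = ereal (\<Sum>d\<in>UNIV. \<integral>a. mvn_density (post_mean (column d Y)) post_cov a
        * ln (mvn_density (post_mean (column d Y)) post_cov a / mvn_density 0 (mat 1) a) \<partial>lborel)"
    by (intro kl_div_prod_columns post_density prob_density_mvn_density mvn_density_pos
        positive_definite_mat_1 kl_post(1))
  then show ?thesis
    unfolding lower_bound_def kl_post(2) by (simp add: sum.distrib)
qed

end

section \<open>Random Fourier features\<close>

lemma sets_uniform_law [measurable_cong, simp]: "sets (uniform_law a b) = sets borel"
  by (simp add: uniform_law_def)

lemma sets_diag_normal [measurable_cong, simp]: "sets (diag_normal m S) = sets borel"
  by (simp add: diag_normal_def)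

lemma prob_space_uniform_law: "prob_space (uniform_law a b)"
proof (cases "a < b")
  case True
  then have "prob_space (uniform_measure lborel {a..b})"
    by (intro prob_space_uniform_measure) simp_all
  with True show ?thesis by (simp add: uniform_law_def)
qed (simp add: uniform_law_def prob_space_return)

lemma prob_space_diag_normal: "prob_space (diag_normal m S)"
  unfolding diag_normal_def
proof (rule prob_space.prob_space_distr)
  show "prob_space (density lborel (mvn_density 0 (mat 1 :: real^'a^'a)))"
    by (intro prob_space_density prob_density_mvn_density positive_definite_mat_1)
qed measurable

lemma prob_space_var_freqs: "prob_space (var_freqs \<mu> S \<alpha> \<beta>)"
  unfolding var_freqs_def
  by (intro prob_space_PiM prob_space_pair prob_space_diag_normal prob_space_uniform_law)

lemma prob_space_prior_freqs: "prob_space prior_freqs"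
  unfolding prior_freqs_def
  by (intro prob_space_PiM prob_space_pair prob_space_uniform_law prob_space_density
      prob_density_mvn_density positive_definite_mat_1)

lemma sets_var_freqs: "sets (var_freqs \<mu> S \<alpha> \<beta>) = sets (\<Pi>\<^sub>M k\<in>UNIV. borel \<Otimes>\<^sub>M borel)"
  unfolding var_freqs_def by (intro sets_PiM_cong sets_pair_measure_cong) simp_all

lemma sets_prior_freqs: "sets prior_freqs = sets (\<Pi>\<^sub>M k\<in>UNIV. borel \<Otimes>\<^sub>M borel)"
  unfolding prior_freqs_def by (intro sets_PiM_cong sets_pair_measure_cong) simp_all

lemma measurable_feature_matrix:
  "(\<lambda>\<omega>. feature_matrix \<sigma> p Lm z X \<omega> $ i $ j) \<in> borel_measurable (var_freqs \<mu> S \<alpha> \<beta>)"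
proof -
  have [measurable]: "(\<lambda>\<omega>. \<omega> j) \<in> (\<Pi>\<^sub>M k\<in>UNIV. borel \<Otimes>\<^sub>M borel) \<rightarrow>\<^sub>M borel \<Otimes>\<^sub>M borel"
    by (rule measurable_component_singleton) simp
  have [measurable]: "(\<lambda>\<omega>. matrix_inv (Lm (fst j)) *v fst (\<omega> j)) \<in> (\<Pi>\<^sub>M k\<in>UNIV. borel \<Otimes>\<^sub>M borel) \<rightarrow>\<^sub>M borel"
    by (rule measurable_compose[OF _ borel_measurable_matrix_vector_mult]) measurable
  have "(\<lambda>\<omega>. feature_matrix \<sigma> p Lm z X \<omega> $ i $ j) \<in> borel_measurable (\<Pi>\<^sub>M k\<in>UNIV. borel \<Otimes>\<^sub>M borel)"
    unfolding feature_matrix_def feature_def vec_lambda_beta by measurable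
  then show ?thesis
    by (simp cong: measurable_cong_sets add: sets_var_freqs)
qed

lemma abs_feature_matrix_le:
  "\<bar>feature_matrix \<sigma> p Lm z X \<omega> $ i $ (j :: 'l::finite \<times> 'k::finite)\<bar>
    \<le> sqrt (2 * (\<sigma> (fst j))\<^sup>2 / real CARD('k))"
  unfolding feature_matrix_def feature_def vec_lambda_beta abs_mult
  by (subst abs_of_nonneg, simp, rule mult_left_le, simp_all)

text \<open>The bound on the cosine holds for every \<omega>, so integrability follows on any
  probability space, with zero variances and intervals of length zero included.\<close>

lemma random_features_feature_matrix:
  assumes "0 < \<tau>"
  shows "random_features (var_freqs \<mu> S \<alpha> \<beta>) (feature_matrix \<sigma> p Lm z X) \<tau>"
proof -
  interpret prob_space "var_freqs \<mu> S \<alpha> \<beta>" by (rule prob_space_var_freqs)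
  let ?\<Phi> = "feature_matrix \<sigma> p Lm z X" and ?b = "\<lambda>j::'a \<times> 'b. sqrt (2 * (\<sigma> (fst j))\<^sup>2 / real CARD('b))"
  note [measurable] = measurable_feature_matrix
  show ?thesis
  proof unfold_locales
    show "integrable (var_freqs \<mu> S \<alpha> \<beta>) (\<lambda>\<omega>. ?\<Phi> \<omega> $ i $ j)" for i j
      by (rule integrable_const_bound[of _ "?b j"])
        (auto simp: abs_feature_matrix_le simp del: real_sqrt_divide)
    show "integrable (var_freqs \<mu> S \<alpha> \<beta>) (\<lambda>\<omega>. (transpose (?\<Phi> \<omega>) ** ?\<Phi> \<omega>) $ i $ j)" for i j
      unfolding matrix_matrix_mult_def transpose_def vec_lambda_beta
    proof (intro Bochner_Integration.integrable_sum integrable_const_bound[of _ "?b i * ?b j"])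
      show "AE \<omega> in var_freqs \<mu> S \<alpha> \<beta>. norm (?\<Phi> \<omega> $ k $ i * ?\<Phi> \<omega> $ k $ j) \<le> ?b i * ?b j" for k
        unfolding real_norm_def abs_mult by (intro AE_I2 mult_mono abs_feature_matrix_le) simp_all
    qed measurable
  qed fact
qed

theorem proposition3:
  fixes X :: "real^'q^'n" and Y :: "real^'d^'n" and \<tau> :: real
    and \<sigma> :: "'l::finite \<Rightarrow> real" and p :: "'l \<Rightarrow> real^'q" and Lm :: "'l \<Rightarrow> real^'q^'q"
    and z :: "'l \<times> 'k::finite \<Rightarrow> real^'q"
    and \<mu> :: "'l \<times> 'k \<Rightarrow> real^'q" and S :: "'l \<times> 'k \<Rightarrow> real^'q^'q"
    and \<alpha> \<beta> :: "'l \<times> 'k \<Rightarrow> real"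
  assumes \<sigma>: "\<And>i. 0 < \<sigma> i"
    and Lm: "\<And>i. diagonal_matrix (Lm i)" "\<And>i. positive_definite (Lm i)"
    and \<tau>: "0 < \<tau>"
    and S: "\<And>k. diagonal_matrix (S k)" "\<And>k. positive_semidefinite (S k)"
    and \<alpha>\<beta>: "\<And>k. 0 \<le> \<alpha> k" "\<And>k. \<alpha> k \<le> \<beta> k" "\<And>k. \<beta> k \<le> 2 * pi"
    and KL: "kl_div (var_freqs \<mu> S \<alpha> \<beta>) prior_freqs < \<infinity>"
  shows
    "let Q = var_freqs \<mu> S \<alpha> \<beta>;
         P = prior_freqs;
         \<Phi> = feature_matrix \<sigma> p Lm z X;
         E\<Phi> = matrix_expectation Q \<Phi>;
         E\<Phi>T = matrix_expectation Q (\<lambda>\<omega>. transpose (\<Phi> \<omega>));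
         \<Sigma> = matrix_inv (matrix_expectation Q (\<lambda>\<omega>. transpose (\<Phi> \<omega>) ** \<Phi> \<omega>) + (1 / \<tau>) *\<^sub>R mat 1);
         q = (\<lambda>d. mvn_density (\<Sigma> *v (E\<Phi>T *v column d Y)) ((1 / \<tau>) *\<^sub>R \<Sigma>))
     in (\<forall>d. prob_density (q d) \<and>
             (\<forall>r. prob_density r \<longrightarrow>
                column_bound Q P \<tau> \<Phi> (column d Y) r \<le> column_bound Q P \<tau> \<Phi> (column d Y) (q d) \<and>
                (column_bound Q P \<tau> \<Phi> (column d Y) r = column_bound Q P \<tau> \<Phi> (column d Y) (q d)
                   \<longrightarrow> (AE a in lborel. r a = q d a)))) \<and>
        lower_bound Q P \<tau> \<Phi> Y q =
          ereal (\<Sum>d\<in>UNIV.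
            - (real CARD('n) / 2) * ln (2 * pi * (1 / \<tau>))
            - \<tau> / 2 * (column d Y \<bullet> column d Y)
            + 1 / 2 * ln (det ((1 / \<tau>) *\<^sub>R \<Sigma>))
            + 1 / 2 * \<tau> * (column d Y \<bullet> (E\<Phi> *v (\<Sigma> *v (E\<Phi>T *v column d Y)))))
          - kl_div Q P"
proof -
  interpret random_features "var_freqs \<mu> S \<alpha> \<beta>" "feature_matrix \<sigma> p Lm z X" \<tau>
    by (rule random_features_feature_matrix[OF \<tau>])
  \<comment> \<open>In \<open>ereal\<close> the hypothesis \<open>KL\<close> alone still allows
    \<open>-\<infinity>\<close>; both laws live on the same product sigma-algebra, which excludes
    that value.\<close>
  have "kl_div (var_freqs \<mu> S \<alpha> \<beta>) prior_freqs \<noteq> - \<infinity>"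
    by (intro kl_div_neq_minus_infinity prob_space_prior_freqs) (simp add: sets_var_freqs sets_prior_freqs)
  with KL have K: "\<bar>kl_div (var_freqs \<mu> S \<alpha> \<beta>) prior_freqs\<bar> \<noteq> \<infinity>"
    by auto
  show ?thesis
    unfolding Let_def matrix_expectation_transpose
    \<comment> \<open>Folding goes from the inside out, since each definition is stated through the
      earlier ones; the mean of the transpose has just become the transpose of the mean.\<close>
    unfolding mean_feat_def[symmetric] gram_def[symmetric]
    unfolding post_matrix_def[symmetric]
    unfolding post_mean_def[symmetric] post_cov_def[symmetric]
    unfolding column_optimum_def[symmetric] lower_bound_post
    using column_bound_optimal[OF _ K] post_density(1) by blast
qed

end
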